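(* There is a polynomial-time algorithm that, given an instance $(G, V_{\rm NT})$ of Non-Terminal Spanning Tree with $k = |V_{\rm NT}|$, outputs an equivalent instance $(\hat G, \hat V_{\rm NT})$ of Non-Terminal Spanning Tree with $|\hat V_{\rm NT}| \le k$ and $|V(\hat G)| \le 3k$. That is, Non-Terminal Spanning Tree admits a $3k$-vertex kernel when parameterized by $k = |V_{\rm NT}|$.
   Context: Non-Terminal Spanning Tree: given a connected undirected graph $G=(V,E)$ and a set $V_{\rm NT}\subseteq V$ with $|V_{\rm NT}| \le |V|-2$, decide whether $G$ has a spanning tree $T$ in which every vertex of $V_{\rm NT}$ has degree at least $2$ (such a tree is called admissible for $V_{\rm NT}$). Two instances are equivalent if both are yes-instances or both are no-instances.
   Formalization: For k = 0 the bound |V(Ĝ)| ≤ 3k = 0 is impossible, since every instance has at least 2 vertices; the formal statement requires |V(Ĝ)| ≤ 2 in that case and |V(Ĝ)| ≤ 3k for every k ≥ 1. *)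

theory Defs
  imports
    "Graph_Theory.Digraph_Component"
    "HOL-Computational_Algebra.Polynomial"
begin

section \<open>Non-Terminal Spanning Tree\<close>

text \<open>
  Finite simple undirected graphs are the symmetric loop-free digraphs \<^locale>\<open>pair_graph\<close>: an
  undirected edge is a pair of opposite arcs, so the degree of a vertex is its out-degree, and an
  undirected cycle is a directed cycle with at least three arcs.  The notions of tree and spanning
  tree in \<^theory>\<open>Graph_Theory.Digraph_Component\<close> are not used, since they forbid exactly the
  directed cycles: a pair of opposite arcs counts as a cycle, an acyclically oriented triangle does
  not.
\<close>

definition undirected_tree :: "'a pair_pre_digraph \<Rightarrow> bool" where
  "undirected_tree T \<longleftrightarrow>
     pair_graph T \<and> Digraph_Component.connected (with_proj T) \<and>
     \<not> (\<exists>c. pre_digraph.cycle (with_proj T) c \<and> 3 \<le> length c)"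

definition undirected_spanning_tree :: "'a pair_pre_digraph \<Rightarrow> 'a pair_pre_digraph \<Rightarrow> bool" where
  "undirected_spanning_tree T G \<longleftrightarrow> undirected_tree T \<and> spanning (with_proj T) (with_proj G)"

definition admissible :: "'a pair_pre_digraph \<Rightarrow> 'a set \<Rightarrow> bool" where
  "admissible T N \<longleftrightarrow> (\<forall>v\<in>N. 2 \<le> out_degree (with_proj T) v)"

definition ntst_instance :: "'a pair_pre_digraph \<Rightarrow> 'a set \<Rightarrow> bool" where
  "ntst_instance G N \<longleftrightarrow>
     pair_graph G \<and> Digraph_Component.connected (with_proj G) \<and>
     N \<subseteq> pverts G \<and> card N + 2 \<le> card (pverts G)"

definition ntst_yes :: "'a pair_pre_digraph \<Rightarrow> 'a set \<Rightarrow> bool" where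
  "ntst_yes G N \<longleftrightarrow> (\<exists>T. undirected_spanning_tree T G \<and> admissible T N)"

text \<open>
  Binary encoding with respect to an arbitrary enumeration of the \<open>n\<close> vertices: \<open>n\<close> in unary,
  a separator, the adjacency matrix row by row, and the characteristic vector of \<open>N\<close>.
\<close>

definition encodes :: "bool list \<Rightarrow> 'a pair_pre_digraph \<Rightarrow> 'a set \<Rightarrow> bool" where
  "encodes w G N \<longleftrightarrow>
     (\<exists>vs. distinct vs \<and> set vs = pverts G \<and>
       w = replicate (length vs) True @ [False] @
           concat (map (\<lambda>u. map (\<lambda>v. (u, v) \<in> parcs G) vs) vs) @
           map (\<lambda>v. v \<in> N) vs)"


section \<open>Polynomial-time computability\<close>

text \<open>
  Structured programs for a random access machine.  The memory is divided into named arrays of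
  natural numbers; a scalar is an array used at index 0 only.  Every assignment and every test costs
  one step.  The available arithmetic is addition and truncated subtraction only, so one step adds
  at most a constant (depending on the program) to the maximal bit length of the numbers in
  memory; hence the unit-cost measure is polynomially related to the running time of Turing machines.
\<close>

type_synonym store = "string \<Rightarrow> nat \<Rightarrow> nat"

datatype exp =
    Num nat
  | Get string exp
  | Add exp exp
  | Sub exp exp

primrec val :: "exp \<Rightarrow> store \<Rightarrow> nat" where
  "val (Num n) s = n"
| "val (Get x e) s = s x (val e s)"
| "val (Add a b) s = val a s + val b s"
| "val (Sub a b) s = val a s - val b s"

datatype com =
    Skip
  | Assign string exp exp
  | Seq com com
  | If exp com com
  | While exp com

text \<open>
  \<open>exec c s t s'\<close>: started in \<open>s\<close>, the program \<open>c\<close> terminates in \<open>s'\<close> after \<open>t\<close> steps.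
  Tests succeed on nonzero values; \<open>Assign x i e\<close> stores the value of \<open>e\<close> in the array \<open>x\<close> at
  index \<open>i\<close>.
\<close>

inductive exec :: "com \<Rightarrow> store \<Rightarrow> nat \<Rightarrow> store \<Rightarrow> bool" where
  Skip: "exec Skip s 1 s"
| Assign: "exec (Assign x i e) s 1 (s(x := (s x)(val i s := val e s)))"
| Seq: "exec c1 s t1 s' \<Longrightarrow> exec c2 s' t2 s'' \<Longrightarrow> exec (Seq c1 c2) s (t1 + t2) s''"
| IfTrue: "val b s \<noteq> 0 \<Longrightarrow> exec c1 s t s' \<Longrightarrow> exec (If b c1 c2) s (t + 1) s'"
| IfFalse: "val b s = 0 \<Longrightarrow> exec c2 s t s' \<Longrightarrow> exec (If b c1 c2) s (t + 1) s'"
| WhileFalse: "val b s = 0 \<Longrightarrow> exec (While b c) s 1 s"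
| WhileTrue: "val b s \<noteq> 0 \<Longrightarrow> exec c s t1 s' \<Longrightarrow> exec (While b c) s' t2 s'' \<Longrightarrow>
    exec (While b c) s (t1 + t2 + 1) s''"

definition input_store :: "bool list \<Rightarrow> store" where
  "input_store w = (\<lambda>x i.
     if x = ''inlen'' \<and> i = 0 then length w
     else if x = ''in'' \<and> i < length w then of_bool (w ! i)
     else 0)"

definition output_word :: "store \<Rightarrow> bool list" where
  "output_word s = map (\<lambda>i. s ''out'' i \<noteq> 0) [0..<s ''outlen'' 0]"

text \<open>
  Nothing is required of the program on words outside of \<open>D\<close>.  The length of the output counts
  towards the running time, since \<open>''outlen''\<close> could exceed the number of cells written.
\<close>

definition poly_time_computable_on :: "bool list set \<Rightarrow> (bool list \<Rightarrow> bool list) \<Rightarrow> bool" where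
  "poly_time_computable_on D f \<longleftrightarrow>
     (\<exists>c. \<exists>p :: nat poly. \<forall>w\<in>D. \<exists>t s.
        exec c (input_store w) t s \<and> output_word s = f w \<and>
        t + length (f w) \<le> poly p (length w))"

end

theory Submission
  imports Defs
begin

text \<open>
  A forest of the connected graph \<open>G\<close> extends to a spanning tree without lowering any degree, so
  \<open>(G, N)\<close> is a yes-instance iff some forest has degree at least two at every vertex of \<open>N\<close>, and
  only the edges meeting \<open>N\<close> matter.  Give every non-terminal two slots and match terminals to
  adjacent slots in such a way that there is a set \<open>X\<close> of non-terminals, all of whose slots are
  taken, such that the unmatched terminals and the partners of \<open>X\<close> have no neighbours in \<open>N\<close>
  outside \<open>X\<close>.  Then in any forest the edges at these terminals can be exchanged for the stars of
  the matching, whose leaves cannot close a circuit, and the unmatched terminals can be deleted; at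
  most \<open>2k\<close> matched ones remain.

  The matching comes from an auction, which needs no search for augmenting paths: an unmatched
  terminal takes over a cheapest adjacent slot and raises its price by one, until the adjacent slots
  of all unmatched terminals have reached a price exceeding the number of slots.
\<close>


section \<open>Forests and spanning trees\<close>

text \<open>Stated for a bare arc relation, so that forests carry no vertex set.
  \<open>map snd c\<close> lists the vertices reached after the start; the length bound excludes
  running back and forth along one edge.\<close>

definition circuit_free :: "'a rel \<Rightarrow> bool" where
  "circuit_free E \<longleftrightarrow>
     \<not> (\<exists>u c. pcas u c u \<and> set c \<subseteq> E \<and> distinct (map snd c) \<and> 3 \<le> length c)"

lemma circuit_free_mono: "circuit_free E \<Longrightarrow> F \<subseteq> E \<Longrightarrow> circuit_free F"
  unfolding circuit_free_def by blast

lemma pcas_append: "pcas u (p @ q) v \<longleftrightarrow> (\<exists>w. pcas u p w \<and> pcas w q v)"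
  by (induct p arbitrary: u) auto

lemma pawalk_verts_conv: "pcas u p v \<Longrightarrow> pawalk_verts u p = u # map snd p"
  by (induct p arbitrary: u) auto

lemma pcas_snd_last: "pcas u p v \<Longrightarrow> p \<noteq> [] \<Longrightarrow> snd (last p) = v"
  by (induct p arbitrary: u) auto

lemma pcas_rtrancl: "pcas u p v \<Longrightarrow> set p \<subseteq> E \<Longrightarrow> (u, v) \<in> E\<^sup>*"
proof (induct p arbitrary: u)
  case (Cons e p)
  then show ?case
    by (cases e) (auto intro: converse_rtrancl_into_rtrancl)
qed simp

text \<open>Rotating the circuit to start just behind \<open>(u, v)\<close> leaves a walk from
  \<open>v\<close> to \<open>u\<close>. Heads are distinct, so this walk never re-enters
  \<open>v\<close> and enters \<open>u\<close> only once; if it used \<open>(v, u)\<close>, it would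
  be that single arc and the circuit would have length two.\<close>

lemma circuit_remove_edge:
  assumes "pcas w c w" "distinct (map snd c)" "3 \<le> length c" "(u, v) \<in> set c"
  obtains r where "pcas v r u" "r \<noteq> []" "set r \<subseteq> set c - {(u, v), (v, u)}"
proof -
  obtain p q where c: "c = p @ (u, v) # q"
    using assms(4) by (meson split_list)
  let ?r = "q @ p"
  have walk: "pcas v ?r u"
    using assms(1) by (auto simp: c pcas_append)
  have dist: "distinct (map snd ?r)" and v: "v \<notin> snd ` set ?r"
    using assms(2) by (auto simp: c)
  have len: "2 \<le> length ?r"
    using assms(3) by (simp add: c)
  have "(v, u) \<notin> set ?r"
  proof
    assume "(v, u) \<in> set ?r"
    then obtain r1 r2 where r: "?r = r1 @ (v, u) # r2"
      by (meson split_list)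
    have 1: "pcas v r1 v" and 2: "pcas u r2 u"
      using walk unfolding r by (auto simp: pcas_append)
    have "r1 = []"
      using pcas_snd_last[OF 1] v unfolding r by (metis UnCI image_eqI last_in_set set_append)
    moreover have "r2 = []"
    proof (rule ccontr)
      assume "r2 \<noteq> []"
      then have "u \<in> snd ` set r2"
        using pcas_snd_last[OF 2] by (metis image_eqI last_in_set)
      then show False
        using dist unfolding r by auto
    qed
    ultimately show False
      using len r by simp
  qed
  moreover have "(u, v) \<notin> set ?r"
    using v by force
  ultimately show thesis
    using walk len by (intro that[of ?r]) (auto simp: c)
qed

text \<open>Once \<open>(u, v)\<close> is removed, the last arc of the remaining walk enters
  \<open>u\<close> from a vertex other than \<open>v\<close>. Hence a vertex with a single neighbour
  lies on no circuit.\<close>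

lemma circuit_two_neighbours:
  assumes "sym E" "pcas w c w" "set c \<subseteq> E" "distinct (map snd c)" "3 \<le> length c" "(u, v) \<in> set c"
  obtains x where "x \<noteq> v" "(u, x) \<in> E"
proof -
  obtain r where r: "pcas v r u" "r \<noteq> []" "set r \<subseteq> set c - {(u, v), (v, u)}"
    using circuit_remove_edge[OF assms(2,4-6)] by blast
  obtain x where "last r = (x, u)"
    using pcas_snd_last[OF r(1,2)] by (metis prod.collapse)
  with r have "(x, u) \<in> set c" "x \<noteq> v"
    by (metis Diff_iff last_in_set subsetD, metis Diff_iff insert_iff last_in_set subsetD)
  with that assms(1,3) show thesis
    by (meson subsetD symD)
qed

text \<open>A circuit through the new edge would leave, after removal of that edge, a walk in
  \<open>E\<close> between its ends.\<close>

lemma circuit_free_insert: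
  assumes "sym E" "circuit_free E" "(a, b) \<notin> E\<^sup>*"
  shows "circuit_free (E \<union> {(a, b), (b, a)})"
  unfolding circuit_free_def
proof (safe)
  fix w c
  assume c: "pcas w c w" "set c \<subseteq> E \<union> {(a, b), (b, a)}" "distinct (map snd c)" "3 \<le> length c"
  have ba: "(b, a) \<notin> E\<^sup>*"
    using assms(1,3) by (meson sym_rtrancl symD)
  have "\<exists>u v. (u, v) \<in> set c \<and> {(u, v), (v, u)} = {(a, b), (b, a)}"
    using c assms(2) unfolding circuit_free_def by blast
  then obtain u v where uv: "(u, v) \<in> set c" and eq: "{(u, v), (v, u)} = {(a, b), (b, a)}"
    by blast
  obtain r where "pcas v r u" "set r \<subseteq> set c - {(u, v), (v, u)}"
    using circuit_remove_edge[OF c(1,3,4) uv] by blast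
  then have "(v, u) \<in> E\<^sup>*"
    using c(2) eq by (intro pcas_rtrancl) auto
  then show False
    using eq assms(3) ba by (auto simp: doubleton_eq_iff)
qed

text \<open>A maximal symmetric circuit-free set between \<open>F\<close> and \<open>E\<close> joins
  the ends of every arc of \<open>E\<close>: an arc whose ends it does not join could be
  added.\<close>

lemma circuit_free_extend_connected:
  assumes "finite V" "E \<subseteq> V \<times> V" "sym E" and conn: "\<And>u v. u \<in> V \<Longrightarrow> v \<in> V \<Longrightarrow> (u, v) \<in> E\<^sup>*"
    and F: "F \<subseteq> E" "sym F" "circuit_free F"
  obtains T where "F \<subseteq> T" "T \<subseteq> E" "sym T" "circuit_free T"
    "\<And>u v. u \<in> V \<Longrightarrow> v \<in> V \<Longrightarrow> (u, v) \<in> T\<^sup>*"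
proof -
  define A where "A = {T. F \<subseteq> T \<and> T \<subseteq> E \<and> sym T \<and> circuit_free T}"
  have "finite E"
    using assms(1,2) by (meson finite_SigmaI finite_subset)
  then have "finite A"
    by (intro finite_subset[of A "Pow E"]) (auto simp: A_def)
  moreover have "F \<in> A"
    using F by (simp add: A_def)
  ultimately have "\<exists>T\<in>A. F \<subseteq> T \<and> (\<forall>T'\<in>A. T \<subseteq> T' \<longrightarrow> T = T')"
    by (rule finite_has_maximal2)
  then obtain T where T: "T \<in> A" and max: "\<forall>T'\<in>A. T \<subseteq> T' \<longrightarrow> T = T'"
    by (elim bexE conjE)
  have "(u, v) \<in> T\<^sup>*" if "(u, v) \<in> E\<^sup>*" for u v
    using that
  proof (induct rule: rtrancl_induct)
    case (step a b)
    have "(a, b) \<in> T\<^sup>*"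
    proof (rule ccontr)
      assume nt: "(a, b) \<notin> T\<^sup>*"
      have "T \<union> {(a, b), (b, a)} \<in> A"
        using T step(2) assms(3) circuit_free_insert[OF _ _ nt] by (auto simp: A_def sym_def)
      then have "T = T \<union> {(a, b), (b, a)}"
        using max by (metis Un_upper1)
      then have "(a, b) \<in> T"
        by auto
      with nt show False
        by (simp add: r_into_rtrancl)
    qed
    with step(3) show ?case
      by (rule rtrancl_trans)
  qed simp
  with conn have "(u, v) \<in> T\<^sup>*" if "u \<in> V" "v \<in> V" for u v
    using that by blast
  with that[of T] T show thesis
    by (simp add: A_def)
qed

section \<open>Library notions in terms of arc relations\<close>

lemma connected_conv:
  assumes "pair_graph G"
  shows "Digraph_Component.connected (with_proj G) \<longleftrightarrow>
    pverts G \<noteq> {} \<and> (\<forall>u\<in>pverts G. \<forall>v\<in>pverts G. (u, v) \<in> (parcs G)\<^sup>*)"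
proof -
  interpret pair_graph G by fact
  have "(u, v) \<in> rtrancl_on (pverts G) (parcs G) \<longleftrightarrow> (u, v) \<in> (parcs G)\<^sup>*"
    if "u \<in> pverts G" "v \<in> pverts G" for u v
    using that in_arcsD2
    by (auto intro: rtrancl_on_rtranclI rtrancl_consistent_rtrancl_on)
  moreover have "parcs (mk_symmetric (with_proj G)) = parcs G"
    by (rule adj_mk_symmetric_eq) (rule pair_sym_arcs)
  ultimately show ?thesis
    by (simp add: Digraph_Component.connected_def strongly_connected_def reachable_def)
qed

lemma pair_graph_conv:
  "pair_graph G \<longleftrightarrow>
     finite (pverts G) \<and> parcs G \<subseteq> pverts G \<times> pverts G \<and> sym (parcs G) \<and> irrefl (parcs G)"
proof
  assume "pair_graph G"
  then interpret pair_graph G .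
  show "finite (pverts G) \<and> parcs G \<subseteq> pverts G \<times> pverts G \<and> sym (parcs G) \<and> irrefl (parcs G)"
    using pair_finite_verts pair_sym_arcs pair_no_loops in_arcsD1 in_arcsD2
    by (force simp: symmetric_def irrefl_def)
next
  assume *: "finite (pverts G) \<and> parcs G \<subseteq> pverts G \<times> pverts G \<and> sym (parcs G) \<and> irrefl (parcs G)"
  then have "finite (parcs G)"
    by (meson finite_SigmaI finite_subset)
  with * show "pair_graph G"
    by unfold_locales (auto simp: symmetric_def irrefl_def)
qed

lemma undirected_tree_conv:
  "undirected_tree T \<longleftrightarrow> pair_graph T \<and> pverts T \<noteq> {} \<and>
     (\<forall>u\<in>pverts T. \<forall>v\<in>pverts T. (u, v) \<in> (parcs T)\<^sup>*) \<and> circuit_free (parcs T)"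
proof (cases "pair_graph T")
  case True
  then interpret pair_graph T .
  have "(\<exists>c. pre_digraph.cycle (with_proj T) c \<and> 3 \<le> length c) \<longleftrightarrow> \<not> circuit_free (parcs T)"
    (is "?L \<longleftrightarrow> ?R")
  proof
    assume ?L
    then obtain u c where "pcas u c u" "set c \<subseteq> parcs T" "distinct (map snd c)" "3 \<le> length c"
      by (auto simp: cycle_def awalk_def pawalk_verts_conv)
    then show ?R
      unfolding circuit_free_def by blast
  next
    assume ?R
    then obtain u c where c: "pcas u c u" "set c \<subseteq> parcs T" "distinct (map snd c)" "3 \<le> length c"
      by (auto simp: circuit_free_def)
    then have "u \<in> pverts T"
      by (cases c) (auto dest: in_arcsD1)
    with c show ?L
      by (auto simp: cycle_def awalk_def pawalk_verts_conv intro!: exI[of _ c] exI[of _ u])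
  qed
  then show ?thesis
    using True connected_conv[OF True] by (auto simp: undirected_tree_def)
qed (simp add: undirected_tree_def)

lemma out_degree_conv: "out_degree (with_proj G) v = card (parcs G `` {v})"
proof -
  have "parcs G `` {v} = snd ` out_arcs (with_proj G) v"
    by (force simp: out_arcs_def)
  moreover have "inj_on snd (out_arcs (with_proj G) v)"
    by (auto simp: out_arcs_def inj_on_def)
  ultimately show ?thesis
    by (simp add: out_degree_def card_image)
qed

text \<open>An admissible tree supplies its own arcs; conversely a forest is completed to a spanning
  tree, which only enlarges neighbourhoods.\<close>

lemma ntst_yes_conv:
  assumes "ntst_instance G N"
  shows "ntst_yes G N \<longleftrightarrow>
    (\<exists>F \<subseteq> parcs G. sym F \<and> circuit_free F \<and> (\<forall>v\<in>N. 2 \<le> card (F `` {v})))"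
proof
  assume "ntst_yes G N"
  then obtain T where T: "undirected_tree T" "parcs T \<subseteq> parcs G" "admissible T N"
    by (auto simp: ntst_yes_def undirected_spanning_tree_def spanning_def subgraph_def)
  then show "\<exists>F \<subseteq> parcs G. sym F \<and> circuit_free F \<and> (\<forall>v\<in>N. 2 \<le> card (F `` {v}))"
    by (intro exI[of _ "parcs T"])
      (simp add: undirected_tree_conv pair_graph_conv admissible_def out_degree_conv)
next
  assume "\<exists>F \<subseteq> parcs G. sym F \<and> circuit_free F \<and> (\<forall>v\<in>N. 2 \<le> card (F `` {v}))"
  then obtain F where F: "F \<subseteq> parcs G" "sym F" "circuit_free F" "\<forall>v\<in>N. 2 \<le> card (F `` {v})"
    by blast
  have G: "pair_graph G" "Digraph_Component.connected (with_proj G)"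
    using assms by (auto simp: ntst_instance_def)
  note conn = connected_conv[OF G(1), THEN iffD1, OF G(2)]
  obtain T where T: "F \<subseteq> T" "T \<subseteq> parcs G" "sym T" "circuit_free T"
    "\<And>u v. u \<in> pverts G \<Longrightarrow> v \<in> pverts G \<Longrightarrow> (u, v) \<in> T\<^sup>*"
    using circuit_free_extend_connected[of "pverts G" "parcs G" F] G(1) conn F
    unfolding pair_graph_conv by metis
  let ?T = "\<lparr>pverts = pverts G, parcs = T\<rparr>"
  have pT: "pair_graph ?T"
    using G(1) T(2,3) by (auto simp: pair_graph_conv irrefl_def)
  then have "undirected_tree ?T"
    using conn T by (auto simp: undirected_tree_conv)
  moreover have "spanning (with_proj ?T) (with_proj G)"
    using T(2) pT G(1)
    by (auto simp: spanning_def subgraph_def compatible_def wf_digraph_wp_iff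
        intro: pair_graph.axioms pair_digraph.axioms pair_fin_digraph.axioms)
  moreover have "finite (T `` {v})" for v
    using pT by (auto simp: pair_graph_conv intro: finite_subset)
  then have "admissible ?T N"
    using F(4) T(1) unfolding admissible_def out_degree_conv
    by (fastforce intro: order_trans[OF _ card_mono])
  ultimately show "ntst_yes G N"
    by (auto simp: ntst_yes_def undirected_spanning_tree_def)
qed


section \<open>The kernel as a graph\<close>

text \<open>Completing the kept terminals to a clique restores connectivity and is harmless, because
  arcs between terminals never contribute to the degree of a non-terminal.\<close>

definition kernel_graph :: "'a pair_pre_digraph \<Rightarrow> 'a set \<Rightarrow> 'a set \<Rightarrow> 'a pair_pre_digraph" where
  "kernel_graph G N K =
     \<lparr>pverts = N \<union> K, parcs = parcs G \<inter> (N \<union> K) \<times> (N \<union> K) \<union> {(u, v). u \<in> K \<and> v \<in> K \<and> u \<noteq> v}\<rparr>"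

text \<open>The pairs in \<open>P\<close> form disjoint stars with at least two leaves, whose leaves are kept terminals
  and whose centres separate the leaves and the discarded terminals from the other non-terminals.\<close>

definition expansion :: "'a pair_pre_digraph \<Rightarrow> 'a set \<Rightarrow> 'a set \<Rightarrow> 'a rel \<Rightarrow> bool" where
  "expansion G N K P \<longleftrightarrow>
     P \<subseteq> parcs G \<and> P \<subseteq> K \<times> N \<and> single_valued P \<and> (\<forall>x\<in>Range P. 2 \<le> card (P\<inverse> `` {x})) \<and>
     (\<forall>b\<in>pverts G - N. b \<notin> K \<or> b \<in> Domain P \<longrightarrow> (\<forall>a\<in>N. (b, a) \<in> parcs G \<longrightarrow> a \<in> Range P))"

lemma kernel_graph_simps [simp]:
  "pverts (kernel_graph G N K) = N \<union> K"
  "parcs (kernel_graph G N K) =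
     parcs G \<inter> (N \<union> K) \<times> (N \<union> K) \<union> {(u, v). u \<in> K \<and> v \<in> K \<and> u \<noteq> v}"
  by (simp_all add: kernel_graph_def)

text \<open>Since the kept terminals form a clique, connectivity follows once every non-terminal
  reaches one of them. This is shown along a walk of \<open>G\<close> to a fixed kept
  terminal.\<close>

lemma ntst_instance_kernel_graph:
  assumes inst: "ntst_instance G N" and K: "K \<subseteq> pverts G - N" "2 \<le> card K"
    and P: "expansion G N K P"
  shows "ntst_instance (kernel_graph G N K) N"
proof -
  have pG: "pair_graph G" and cG: "Digraph_Component.connected (with_proj G)" and N: "N \<subseteq> pverts G"
    using inst by (auto simp: ntst_instance_def)
  have G: "finite (pverts G)" "parcs G \<subseteq> pverts G \<times> pverts G" "sym (parcs G)" "irrefl (parcs G)"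
    using pG by (auto simp: pair_graph_conv)
  let ?E = "parcs (kernel_graph G N K)"
  have finN: "finite N" and finK: "finite K"
    using N K G(1) by (auto intro: finite_subset)
  have symE: "sym ?E"
    using G(3) by (auto simp: sym_def)
  then have pK: "pair_graph (kernel_graph G N K)"
    using finN finK G(4) by (auto simp: pair_graph_conv irrefl_def)
  obtain b where b: "b \<in> K"
    using K(2) by fastforce
  have to_K: "\<exists>k\<in>K. (a, k) \<in> ?E\<^sup>*" if a: "a \<in> N" for a
  proof -
    have "(a, b) \<in> (parcs G)\<^sup>*"
      using connected_conv[OF pG] cG a b N K by auto
    then have "a \<in> N \<longrightarrow> (\<exists>k\<in>K. (a, k) \<in> ?E\<^sup>*)"
    proof (induct rule: converse_rtrancl_induct)
      case base
      then show ?case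
        using b by blast
    next
      case (step x y)
      show ?case
      proof
        assume x: "x \<in> N"
        consider "y \<in> N" | "y \<in> K" | "y \<in> pverts G - N" "y \<notin> K"
          using step(1) G(2) by auto
        then show "\<exists>k\<in>K. (x, k) \<in> ?E\<^sup>*"
        proof cases
          case 1
          then obtain k where "k \<in> K" "(y, k) \<in> ?E\<^sup>*"
            using step(3) by blast
          moreover have "(x, y) \<in> ?E"
            using step(1) x 1 by simp
          ultimately show ?thesis
            by (meson converse_rtrancl_into_rtrancl)
        next
          case 2
          then have "(x, y) \<in> ?E"
            using step(1) x by simp
          with 2 show ?thesis
            by blast
        next
          \<comment> \<open>Here the walk leaves the kernel at a discarded terminal
            \<open>y\<close>; its neighbour \<open>x\<close> is then a star centre and has a leaf in
            \<open>K\<close>.\<close>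
          case 3
          have "(y, x) \<in> parcs G"
            using step(1) G(3) by (meson symD)
          then have "x \<in> Range P"
            using P 3 x unfolding expansion_def by blast
          then obtain k where k: "(k, x) \<in> P"
            by blast
          then have "(x, k) \<in> parcs G" "k \<in> K"
            using P G(3) unfolding expansion_def by (meson subsetD symD, blast)
          then have "(x, k) \<in> ?E"
            using x by simp
          with \<open>k \<in> K\<close> show ?thesis
            by blast
        qed
      qed
    qed
    with a show ?thesis
      by blast
  qed
  have to_K': "\<exists>k\<in>K. (u, k) \<in> ?E\<^sup>*" if "u \<in> N \<union> K" for u
    using that to_K by blast
  have "(u, v) \<in> ?E\<^sup>*" if uv: "u \<in> N \<union> K" "v \<in> N \<union> K" for u v
  proof -
    obtain k l where kl: "k \<in> K" "l \<in> K" "(u, k) \<in> ?E\<^sup>*" "(v, l) \<in> ?E\<^sup>*"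
      using to_K'[OF uv(1)] to_K'[OF uv(2)] by blast
    have "(k, l) \<in> ?E\<^sup>*"
      using kl(1,2) by (cases "k = l") auto
    moreover have "(l, v) \<in> ?E\<^sup>*"
      using kl(4) symE by (meson sym_rtrancl symD)
    ultimately show ?thesis
      using kl(3) by (meson rtrancl_trans)
  qed
  then have "Digraph_Component.connected (with_proj (kernel_graph G N K))"
    using b by (subst connected_conv[OF pK]) auto
  moreover have "card (N \<union> K) = card N + card K"
    using finN finK K by (intro card_Un_disjoint) auto
  ultimately show ?thesis
    using pK K(2) by (simp add: ntst_instance_def)
qed

text \<open>Towards the kernel, the arcs at discarded terminals and at leaves are traded for the
  stars of \<open>P\<close>; back to \<open>G\<close>, the arcs between terminals are
  dropped.\<close>

lemma ntst_yes_kernel_graph: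
  assumes inst: "ntst_instance G N" and K: "K \<subseteq> pverts G - N" "2 \<le> card K"
    and P: "expansion G N K P"
  shows "ntst_yes (kernel_graph G N K) N \<longleftrightarrow> ntst_yes G N"
proof -
  have pG: "pair_graph G" and N: "N \<subseteq> pverts G"
    using inst by (auto simp: ntst_instance_def)
  have G: "finite (pverts G)" "parcs G \<subseteq> pverts G \<times> pverts G" "sym (parcs G)"
    using pG by (auto simp: pair_graph_conv)
  have P1: "P \<subseteq> parcs G" "P \<subseteq> K \<times> N" "single_valued P"
    and P2: "\<And>x. x \<in> Range P \<Longrightarrow> 2 \<le> card (P\<inverse> `` {x})"
    and P3: "\<And>b a. b \<in> pverts G - N \<Longrightarrow> b \<notin> K \<or> b \<in> Domain P \<Longrightarrow> a \<in> N \<Longrightarrow>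
      (b, a) \<in> parcs G \<Longrightarrow> a \<in> Range P"
    using P by (auto simp: expansion_def)
  let ?E = "parcs (kernel_graph G N K)"
  have "\<exists>F \<subseteq> ?E. sym F \<and> circuit_free F \<and> (\<forall>v\<in>N. 2 \<le> card (F `` {v}))"
    if "F \<subseteq> parcs G" "sym F" "circuit_free F" and deg: "\<forall>v\<in>N. 2 \<le> card (F `` {v})" for F
  proof -
    \<comment> \<open>\<open>Z\<close> collects the terminals that give up their arcs of
      \<open>F\<close>; in \<open>F'\<close> its leaves are attached to their centres and the others
      become isolated.\<close>
    define Z where "Z = (pverts G - N - K) \<union> Domain P"
    define F' where "F' = F \<inter> (- Z) \<times> (- Z) \<union> P \<union> P\<inverse>"
    have sub: "F' \<subseteq> ?E"
    proof -
      have "F \<inter> (- Z) \<times> (- Z) \<subseteq> parcs G \<inter> (N \<union> K) \<times> (N \<union> K)"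
        using that(1) G(2) by (auto simp: Z_def)
      moreover have "P \<union> P\<inverse> \<subseteq> parcs G \<inter> (N \<union> K) \<times> (N \<union> K)"
        using P1(1,2) G(3) by (auto dest: symD)
      ultimately show ?thesis
        by (auto simp: F'_def)
    qed
    have sym': "sym F'"
      using that(2) by (auto simp: F'_def sym_def)
    have "circuit_free F'"
      unfolding circuit_free_def
    proof safe
      fix w c
      assume c: "pcas w c w" "set c \<subseteq> F'" "distinct (map snd c)" "3 \<le> length c"
      \<comment> \<open>In \<open>F'\<close> a leaf is adjacent to its centre only, because
        \<open>P\<close> is single-valued, whereas a vertex on a circuit has two neighbours.\<close>
      have no_leaf: "u \<notin> Domain P" if uv: "(u, v) \<in> set c" for u v
      proof
        assume u: "u \<in> Domain P"
        obtain x where "x \<noteq> v" "(u, x) \<in> F'"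
          using circuit_two_neighbours[OF sym' c uv] .
        moreover have "(u, v) \<in> F'"
          using uv c(2) by blast
        moreover have "u \<notin> N"
          using u P1(2) K(1) by blast
        then have "(u, x) \<in> P" if "(u, x) \<in> F'" for x
          using that u P1(2) by (auto simp: F'_def Z_def)
        ultimately show False
          using P1(3) by (meson single_valuedD)
      qed
      \<comment> \<open>A circuit that enters \<open>v\<close> also leaves it, so the previous fact
        excludes leaves as heads as well.\<close>
      moreover have "v \<notin> Domain P" if uv: "(u, v) \<in> set c" for u v
      proof -
        obtain r where r: "pcas v r u" "r \<noteq> []" "set r \<subseteq> set c - {(u, v), (v, u)}"
          using circuit_remove_edge[OF c(1,3,4) uv] .
        then have "\<exists>x. (v, x) \<in> set r"
          by (cases r) auto
        then obtain x where "(v, x) \<in> set r" ..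
        with r(3) no_leaf show ?thesis
          by blast
      qed
      ultimately have "set c \<subseteq> F"
        using c(2) unfolding F'_def by fast
      with c that(3) show False
        unfolding circuit_free_def by blast
    qed
    moreover have "2 \<le> card (F' `` {a})" if a: "a \<in> N" for a
    proof -
      have "F' `` {a} \<subseteq> N \<union> K"
        using sub by auto
      then have fin: "finite (F' `` {a})"
        by (rule finite_subset) (use N K G(1) in \<open>auto intro: finite_subset\<close>)
      show ?thesis
      proof (cases "a \<in> Range P")
        case True
        have "P\<inverse> `` {a} \<subseteq> F' `` {a}"
          by (auto simp: F'_def)
        with P2[OF True] card_mono[OF fin this] show ?thesis
          by linarith
      next
        \<comment> \<open>A non-terminal that is not a centre has no neighbour in \<open>Z\<close>,
          so all its arcs of \<open>F\<close> survive.\<close>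
        case False
        have "F `` {a} \<subseteq> F' `` {a}"
        proof
          fix w
          assume "w \<in> F `` {a}"
          then have aw: "(a, w) \<in> F" "(w, a) \<in> parcs G"
            using \<open>F \<subseteq> parcs G\<close> G(3) by (auto dest: symD)
          have "w \<notin> Z"
            using P3[of w a] aw(2) a False K(1) P1(2) by (auto simp: Z_def)
          moreover have "a \<notin> Z"
            using a P1(2) K(1) by (auto simp: Z_def)
          ultimately show "w \<in> F' `` {a}"
            using aw(1) by (auto simp: F'_def)
        qed
        with deg a card_mono[OF fin this] show ?thesis
          by fastforce
      qed
    qed
    ultimately show ?thesis
      using sub sym' by blast
  qed
  moreover have "\<exists>F \<subseteq> parcs G. sym F \<and> circuit_free F \<and> (\<forall>v\<in>N. 2 \<le> card (F `` {v}))"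
    if F: "F \<subseteq> ?E" "sym F" "circuit_free F" "\<forall>v\<in>N. 2 \<le> card (F `` {v})" for F
  proof -
    \<comment> \<open>The arcs added to \<open>G\<close> join two terminals, so none of them meets
      \<open>N\<close>.\<close>
    let ?F = "F \<inter> (N \<times> UNIV \<union> UNIV \<times> N)"
    have "?F \<subseteq> parcs G"
      using F(1) K(1) by auto
    moreover have "sym ?F"
      using F(2) by (auto simp: sym_def)
    moreover have "circuit_free ?F"
      using F(3) by (rule circuit_free_mono) blast
    moreover have "?F `` {v} = F `` {v}" if "v \<in> N" for v
      using that by auto
    ultimately show ?thesis
      using F(4) by (intro exI[of _ ?F]) auto
  qed
  ultimately show ?thesis
    unfolding ntst_yes_conv[OF inst] ntst_yes_conv[OF ntst_instance_kernel_graph[OF assms]]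
    by blast
qed


section \<open>Matching by an ascending auction\<close>

text \<open>
  Bidders \<open>b \<noteq> 0\<close> bid for slots \<open>s < S\<close> with prices \<open>h\<close>; \<open>own s\<close> is the holder of slot \<open>s\<close>, with
  \<open>0\<close> for none, and \<open>mt b\<close> tells whether \<open>b\<close> holds a slot.
\<close>

definition auction_inv ::
  "(nat \<Rightarrow> nat \<Rightarrow> bool) \<Rightarrow> nat \<Rightarrow> (nat \<Rightarrow> nat) \<Rightarrow> (nat \<Rightarrow> nat) \<Rightarrow> (nat \<Rightarrow> nat) \<Rightarrow> bool" where
  "auction_inv R S h own mt \<longleftrightarrow>
     (\<forall>s<S. own s \<noteq> 0 \<longrightarrow>
        R (own s) s \<and> mt (own s) \<noteq> 0 \<and> (\<forall>s'<S. R (own s) s' \<longrightarrow> h s \<le> Suc (h s'))) \<and>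
     (\<forall>s<S. own s = 0 \<longrightarrow> h s = 0) \<and>
     (\<forall>s<S. \<forall>s'<S. own s = own s' \<longrightarrow> own s \<noteq> 0 \<longrightarrow> s = s') \<and>
     (\<forall>b. b \<noteq> 0 \<and> mt b \<noteq> 0 \<longrightarrow> (\<exists>s<S. own s = b))"

text \<open>After paying a minimal price plus one, \<open>b\<close> satisfies the near-optimality
  clause (complementary slackness with error one), and price rises elsewhere preserve it for the
  other holders. The displaced holder had only this slot and becomes unmatched; if the slot was
  free, the write hits cell 0 of \<open>mt\<close>, which the invariant ignores.\<close>

lemma auction_inv_bid:
  assumes inv: "auction_inv R S h own mt" and j: "j < S" "R b j" and b: "b \<noteq> 0" "mt b = 0"
    and cheapest: "\<And>s. s < S \<Longrightarrow> R b s \<Longrightarrow> h j \<le> h s"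
  shows "auction_inv R S (h(j := Suc (h j))) (own(j := b)) (mt(own j := 0, b := Suc 0))"
proof -
  have i1: "\<And>s. s < S \<Longrightarrow> own s \<noteq> 0 \<Longrightarrow> R (own s) s \<and> mt (own s) \<noteq> 0"
    and i2: "\<And>s s'. s < S \<Longrightarrow> own s \<noteq> 0 \<Longrightarrow> s' < S \<Longrightarrow> R (own s) s' \<Longrightarrow> h s \<le> Suc (h s')"
    and i3: "\<And>s. s < S \<Longrightarrow> own s = 0 \<Longrightarrow> h s = 0"
    and i4: "\<And>s s'. s < S \<Longrightarrow> s' < S \<Longrightarrow> own s = own s' \<Longrightarrow> own s \<noteq> 0 \<Longrightarrow> s = s'"
    and i5: "\<And>b. b \<noteq> 0 \<Longrightarrow> mt b \<noteq> 0 \<Longrightarrow> \<exists>s<S. own s = b"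
    using inv unfolding auction_inv_def by blast+
  have nb: "own s \<noteq> b" if "s < S" for s
    using i1[OF that] b by metis
  have nj: "own s \<noteq> own j" if "s < S" "s \<noteq> j" "own s \<noteq> 0" for s
    using i4[OF that(1) j(1)] that by blast
  let ?h = "h(j := Suc (h j))" and ?own = "own(j := b)" and ?mt = "mt(own j := 0, b := Suc 0)"
  have "R (?own s) s \<and> ?mt (?own s) \<noteq> 0 \<and> (\<forall>s'<S. R (?own s) s' \<longrightarrow> ?h s \<le> Suc (?h s'))"
    if s: "s < S" "?own s \<noteq> 0" for s
  proof (cases "s = j")
    case True
    then show ?thesis
      using j cheapest by auto
  next
    case False
    with s have own: "own s \<noteq> 0"
      by simp
    have "h s \<le> Suc (?h s')" if "s' < S" "R (own s) s'" for s'
      using i2[OF s(1) own that] by (cases "s' = j") simp_all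
    with False show ?thesis
      using i1[OF s(1) own] nb[OF s(1)] nj[OF s(1) False own] by simp
  qed
  moreover have "?h s = 0" if "s < S" "?own s = 0" for s
    using that i3 b(1) by (cases "s = j") simp_all
  moreover have "s = s'" if "s < S" "s' < S" "?own s = ?own s'" "?own s \<noteq> 0" for s s'
    using that i4[of s s'] nb[of s] nb[of s'] by (cases "s = j"; cases "s' = j") simp_all
  moreover have "\<exists>s<S. ?own s = b'" if b': "b' \<noteq> 0 \<and> ?mt b' \<noteq> 0" for b'
  proof (cases "b' = b")
    case True
    then show ?thesis
      using j(1) by auto
  next
    case False
    with b' have "b' \<noteq> own j" "mt b' \<noteq> 0"
      by (metis fun_upd_apply)+
    then obtain s where "s < S" "own s = b'"
      using i5 b' by blast
    with \<open>b' \<noteq> own j\<close> show ?thesis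
      by (metis fun_upd_apply)
  qed
  ultimately show ?thesis
    unfolding auction_inv_def by blast
qed

text \<open>There are more positive prices than slots, so some price \<open>i\<close> is not attained; the slots
  above this gap are all held, and only they are adjacent to their holders and to the losers.\<close>

lemma auction_closed_slots:
  assumes inv: "auction_inv R S h own mt" and "S < H"
    and losers: "\<And>b s. b \<noteq> 0 \<Longrightarrow> mt b = 0 \<Longrightarrow> s < S \<Longrightarrow> R b s \<Longrightarrow> H \<le> h s"
  obtains X where "X \<subseteq> {..<S}" "\<And>s. s \<in> X \<Longrightarrow> own s \<noteq> 0"
    "\<And>b s. b \<noteq> 0 \<Longrightarrow> mt b = 0 \<or> b \<in> own ` X \<Longrightarrow> s < S \<Longrightarrow> R b s \<Longrightarrow> s \<in> X"
proof -
  have "card (h ` {..<S}) < card {1..H}"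
    using card_image_le[of "{..<S}" h] \<open>S < H\<close> by simp
  then have "\<not> {1..H} \<subseteq> h ` {..<S}"
    by (metis card_mono finite_imageI finite_lessThan not_le)
  then obtain i where i: "1 \<le> i" "i \<le> H" "\<And>s. s < S \<Longrightarrow> h s \<noteq> i"
    by fastforce
  define X where "X = {s. s < S \<and> i < h s}"
  show thesis
  proof (rule that[of X])
    show "own s \<noteq> 0" if "s \<in> X" for s
      using that inv by (fastforce simp: X_def auction_inv_def)
  next
    fix b s
    assume b: "b \<noteq> 0" "mt b = 0 \<or> b \<in> own ` X" and s: "s < S" "R b s"
    \<comment> \<open>Reaching price \<open>i\<close> suffices, since no slot has exactly this
      price. A holder of a slot above the gap paid at most one more than any of its adjacent slots
      costs.\<close>
    from b(2) have "i \<le> h s"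
    proof
      assume "mt b = 0"
      then show ?thesis
        using losers[OF b(1) _ s] i(2) by linarith
    next
      assume "b \<in> own ` X"
      then obtain s' where "s' < S" "i < h s'" "own s' = b"
        by (auto simp: X_def)
      then have "h s' \<le> Suc (h s)"
        using inv s b(1) unfolding auction_inv_def by blast
      with \<open>i < h s'\<close> show ?thesis
        by simp
    qed
    with i(3)[OF s(1)] s(1) show "s \<in> X"
      by (simp add: X_def)
  qed (auto simp: X_def)
qed


section \<open>Total correctness with time bounds\<close>

text \<open>Asserts the existence of a run, the form that \<open>poly_time_computable_on\<close>
  asks for; \<open>T\<close> is only an upper bound on its steps.\<close>

definition wp :: "com \<Rightarrow> store \<Rightarrow> (store \<Rightarrow> bool) \<Rightarrow> nat \<Rightarrow> bool" where
  "wp c s Q T \<longleftrightarrow> (\<exists>t s'. exec c s t s' \<and> t \<le> T \<and> Q s')"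

inductive_cases exec_SkipE: "exec Skip s t s'"
inductive_cases exec_AssignE: "exec (Assign x i e) s t s'"
inductive_cases exec_SeqE: "exec (Seq c1 c2) s t s'"

lemma wp_mono: "wp c s Q T \<Longrightarrow> T \<le> T' \<Longrightarrow> (\<And>s'. Q s' \<Longrightarrow> Q' s') \<Longrightarrow> wp c s Q' T'"
  unfolding wp_def by (meson le_trans)

lemma wp_Skip [simp]: "wp Skip s Q T \<longleftrightarrow> 1 \<le> T \<and> Q s"
  unfolding wp_def by (metis exec.Skip exec_SkipE)

lemma wp_Assign [simp]:
  "wp (Assign x i e) s Q T \<longleftrightarrow> 1 \<le> T \<and> Q (s(x := (s x)(val i s := val e s)))"
  unfolding wp_def by (metis exec.Assign exec_AssignE)

lemma wp_Seq: "wp c1 s (\<lambda>s'. wp c2 s' Q T2) T1 \<Longrightarrow> T1 + T2 \<le> T \<Longrightarrow> wp (Seq c1 c2) s Q T"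
  unfolding wp_def by (elim exE conjE) (blast intro: exec.Seq le_trans[OF add_mono])

text \<open>As an equivalence this lets the simplifier execute straight-line code symbolically and
  count its steps.\<close>

lemma wp_Seq_Assign [simp]:
  "wp (Seq (Assign x i e) c) s Q T \<longleftrightarrow>
     1 \<le> T \<and> wp c (s(x := (s x)(val i s := val e s))) Q (T - 1)"
proof
  assume "wp (Seq (Assign x i e) c) s Q T"
  then show "1 \<le> T \<and> wp c (s(x := (s x)(val i s := val e s))) Q (T - 1)"
    unfolding wp_def
  proof (elim exE conjE)
    fix t s'
    assume "exec (Seq (Assign x i e) c) s t s'" "t \<le> T" and Q: "Q s'"
    then obtain t' where "exec c (s(x := (s x)(val i s := val e s))) t' s'" "1 \<le> T" "t' \<le> T - 1"
      by (elim exec_SeqE exec_AssignE) auto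
    with Q show "1 \<le> T \<and>
        (\<exists>t s'. exec c (s(x := (s x)(val i s := val e s))) t s' \<and> t \<le> T - 1 \<and> Q s')"
      by blast
  qed
next
  assume "1 \<le> T \<and> wp c (s(x := (s x)(val i s := val e s))) Q (T - 1)"
  then show "wp (Seq (Assign x i e) c) s Q T"
    by (intro wp_Seq[of _ _ _ _ "T - 1" 1]) auto
qed

lemma wp_If [simp]:
  "wp (If b c1 c2) s Q T \<longleftrightarrow>
     1 \<le> T \<and> (if val b s \<noteq> 0 then wp c1 s Q (T - 1) else wp c2 s Q (T - 1))"
proof
  assume "wp (If b c1 c2) s Q T"
  then obtain t s' where "exec (If b c1 c2) s t s'" "t \<le> T" "Q s'"
    unfolding wp_def by blast
  then show "1 \<le> T \<and> (if val b s \<noteq> 0 then wp c1 s Q (T - 1) else wp c2 s Q (T - 1))"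
  proof cases
    case (IfTrue t')
    then have "t' \<le> T - 1"
      using \<open>t \<le> T\<close> by simp
    with IfTrue \<open>t \<le> T\<close> \<open>Q s'\<close> show ?thesis
      unfolding wp_def by auto
  next
    case (IfFalse t')
    then have "t' \<le> T - 1"
      using \<open>t \<le> T\<close> by simp
    with IfFalse \<open>t \<le> T\<close> \<open>Q s'\<close> show ?thesis
      unfolding wp_def by auto
  qed
next
  assume "1 \<le> T \<and> (if val b s \<noteq> 0 then wp c1 s Q (T - 1) else wp c2 s Q (T - 1))"
  then obtain t s' where "1 \<le> T" "t \<le> T - 1" and t: "Q s'"
    and "if val b s \<noteq> 0 then exec c1 s t s' else exec c2 s t s'"
    unfolding wp_def by (cases "val b s \<noteq> 0") auto
  then have "exec (If b c1 c2) s (t + 1) s'"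
    by (metis exec.IfTrue exec.IfFalse)
  moreover have "t + 1 \<le> T"
    using \<open>1 \<le> T\<close> \<open>t \<le> T - 1\<close> by simp
  ultimately show "wp (If b c1 c2) s Q T"
    using t unfolding wp_def by blast
qed

text \<open>The invariant is indexed by the number of completed rounds, and there are exactly
  \<open>m\<close>. Each costs its body and one test; the last summand is the failing test.\<close>

lemma wp_While:
  assumes "I 0 s"
    and "\<And>i s. i < m \<Longrightarrow> I i s \<Longrightarrow> val b s \<noteq> 0 \<and> wp c s (I (Suc i)) T"
    and "\<And>s. I m s \<Longrightarrow> val b s = 0 \<and> Q s"
  shows "wp (While b c) s Q (m * (T + 1) + 1)"
proof -
  have "wp (While b c) s Q (k * (T + 1) + 1)" if "I i s" "i + k = m" for i k s
    using that
  proof (induct k arbitrary: i s)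
    case 0
    then show ?case
      using assms(3)[of s] exec.WhileFalse[of b s c] unfolding wp_def by auto
  next
    case (Suc k)
    then obtain t1 s1 where 1: "val b s \<noteq> 0" "exec c s t1 s1" "t1 \<le> T" "I (Suc i) s1"
      using assms(2)[of i s] unfolding wp_def by auto
    obtain t2 s2 where 2: "exec (While b c) s1 t2 s2" "t2 \<le> k * (T + 1) + 1" "Q s2"
      using Suc.hyps[OF 1(4)] Suc.prems(2) unfolding wp_def by auto
    show ?case
      unfolding wp_def
      using exec.WhileTrue[OF 1(1,2) 2(1)] 1(3) 2(2,3)
      by (intro exI[of _ "t1 + t2 + 1"] exI[of _ s2]) simp
  qed
  from this[of 0 s m] assms(1) show ?thesis
    by simp
qed

abbreviation V :: "string \<Rightarrow> exp" where
  "V x \<equiv> Get x (Num 0)"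

definition For :: "string \<Rightarrow> exp \<Rightarrow> com \<Rightarrow> com" where
  "For x e c =
     Seq (Assign x (Num 0) (Num 0))
       (While (Sub e (V x)) (Seq c (Assign x (Num 0) (Add (V x) (Num 1)))))"

text \<open>The limit \<open>e\<close> is re-evaluated at every test, hence the assumption
  \<open>bound\<close>. A round costs its body, the test and the increment; initialisation and the
  failing test add two.\<close>

lemma wp_For:
  assumes init: "I 0 (s(x := (s x)(0 := 0)))"
    and body: "\<And>i s. i < m \<Longrightarrow> s x 0 = i \<Longrightarrow> I i s \<Longrightarrow>
      wp c s (\<lambda>s'. s' x 0 = i \<and> I (Suc i) (s'(x := (s' x)(0 := Suc i)))) T"
    and bound: "\<And>i s. i \<le> m \<Longrightarrow> s x 0 = i \<Longrightarrow> I i s \<Longrightarrow> val e s = m"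
    and exit: "\<And>s. s x 0 = m \<Longrightarrow> I m s \<Longrightarrow> Q s"
    and time: "m * (T + 2) + 2 \<le> T'"
  shows "wp (For x e c) s Q T'"
proof -
  let ?s = "s(x := (s x)(0 := 0))"
  have "wp (While (Sub e (V x)) (Seq c (Assign x (Num 0) (Add (V x) (Num 1))))) ?s Q
      (m * ((T + 1) + 1) + 1)"
  proof (rule wp_While[where I = "\<lambda>i s. i \<le> m \<and> s x 0 = i \<and> I i s"])
    show "0 \<le> m \<and> ?s x 0 = 0 \<and> I 0 ?s"
      using init by simp
  next
    fix i s
    assume i: "i < m" and s: "i \<le> m \<and> s x 0 = i \<and> I i s"
    show "val (Sub e (V x)) s \<noteq> 0 \<and> wp (Seq c (Assign x (Num 0) (Add (V x) (Num 1)))) s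
        (\<lambda>s. Suc i \<le> m \<and> s x 0 = Suc i \<and> I (Suc i) s) (T + 1)"
    proof
      show "val (Sub e (V x)) s \<noteq> 0"
        using bound[of i s] i s by simp
      show "wp (Seq c (Assign x (Num 0) (Add (V x) (Num 1)))) s
          (\<lambda>s. Suc i \<le> m \<and> s x 0 = Suc i \<and> I (Suc i) s) (T + 1)"
        by (rule wp_Seq[where ?T1.0 = T and ?T2.0 = 1], rule wp_mono[OF body[of i s]])
          (use i s in auto)
    qed
  qed (use bound[of m] exit in auto)
  then have "wp (For x e c) s Q (m * (T + 2) + 2)"
    by (simp add: For_def)
  then show ?thesis
    by (rule wp_mono[OF _ time])
qed


section \<open>The kernelization program\<close>

definition adj_exp :: "exp \<Rightarrow> exp \<Rightarrow> exp" where
  "adj_exp u v = Get ''in'' (Add (Get ''row'' u) v)"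

definition nt_exp :: "exp \<Rightarrow> exp" where
  "nt_exp v = adj_exp (V ''n'') v"

definition read_size :: com where
  "read_size = While (Get ''in'' (V ''n'')) (Assign ''n'' (Num 0) (Add (V ''n'') (Num 1)))"

text \<open>Multiplication is not available, so the offsets of the matrix rows are tabulated in \<open>row\<close>,
  with the characteristic vector as row \<open>n\<close>.  The slots \<open>a\<close> and \<open>a + n\<close> belong to vertex \<open>a\<close>;
  \<open>vx\<close> tabulates this map.\<close>

definition index_input :: com where
  "index_input = Seq (Assign ''row'' (Num 0) (Add (V ''n'') (Num 1)))
     (For ''i'' (V ''n'')
       (Seq (Assign ''row'' (Add (V ''i'') (Num 1)) (Add (Get ''row'' (V ''i'')) (V ''n'')))
       (Seq (Assign ''vx'' (V ''i'') (V ''i''))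
            (Assign ''vx'' (Add (V ''i'') (V ''n'')) (V ''i'')))))"

text \<open>The test is a conjunction: \<open>x + y - (1 + z)\<close> with truncated subtraction is nonzero for
  \<open>x, y \<le> 1\<close> iff \<open>x = y = 1\<close> and \<open>z = 0\<close>.  Terminal \<open>b\<close> is the bidder \<open>b + 1\<close>, because \<open>0\<close> in
  \<open>own\<close> marks a free slot; the cell \<open>mt 0\<close> is junk.\<close>

definition bid :: com where
  "bid = If (Sub (Add (adj_exp (V ''b'') (Get ''vx'' (V ''s''))) (nt_exp (Get ''vx'' (V ''s''))))
        (Add (Num 1) (Add (nt_exp (V ''b'')) (Add (Get ''mt'' (Add (V ''b'') (Num 1)))
          (Add (Sub (V ''d'') (Get ''h'' (V ''s''))) (Sub (Get ''h'' (V ''s'')) (V ''d'')))))))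
     (Seq (Assign ''mt'' (Get ''own'' (V ''s'')) (Num 0))
     (Seq (Assign ''own'' (V ''s'') (Add (V ''b'') (Num 1)))
     (Seq (Assign ''mt'' (Add (V ''b'') (Num 1)) (Num 1))
          (Assign ''h'' (V ''s'') (Add (V ''d'') (Num 1))))))
     Skip"

text \<open>Bids are accepted up to price \<open>2n + 1\<close>, so there are at most \<open>2n (2n + 1)\<close> of them, which is
  less than \<open>4 (n + 1)\<^sup>2\<close>, four times the input length.\<close>

definition auction :: com where
  "auction =
     For ''t'' (Add (Add (V ''inlen'') (V ''inlen'')) (Add (V ''inlen'') (V ''inlen'')))
       (For ''b'' (V ''n'')
         (For ''d'' (Add (Add (V ''n'') (V ''n'')) (Num 1))
           (For ''s'' (Add (V ''n'') (V ''n'')) bid)))"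

definition count_matched :: com where
  "count_matched =
     For ''i'' (V ''n'') (If (Get ''mt'' (Add (V ''i'') (Num 1)))
       (Assign ''c'' (Num 0) (Add (V ''c'') (Num 1))) Skip)"

text \<open>An instance must have at least two terminals.\<close>

definition top_up :: com where
  "top_up =
     For ''i'' (V ''n'')
       (If (Sub (Num 2) (Add (V ''c'') (Add (Add (nt_exp (V ''i'')) (nt_exp (V ''i'')))
           (Add (Get ''mt'' (Add (V ''i'') (Num 1))) (Get ''mt'' (Add (V ''i'') (Num 1)))))))
         (Seq (Assign ''mt'' (Add (V ''i'') (Num 1)) (Num 1))
              (Assign ''c'' (Num 0) (Add (V ''c'') (Num 1))))
         Skip)"

definition emit :: "exp \<Rightarrow> com" where
  "emit e = Seq (Assign ''out'' (V ''outlen'') e)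
     (Assign ''outlen'' (Num 0) (Add (V ''outlen'') (Num 1)))"

text \<open>After \<open>top_up\<close>, the array \<open>mt\<close> marks the terminals to be kept,
  whether matched or added.\<close>

definition for_kept :: "string \<Rightarrow> com \<Rightarrow> com" where
  "for_kept x c =
     For x (V ''n'') (If (Add (nt_exp (V x)) (Get ''mt'' (Add (V x) (Num 1)))) c Skip)"

text \<open>With truncated subtraction the inner \<open>Sub (Num 1)\<close> is the test for
  \<open>u = v\<close>, the outer one a negated disjunction. The value may be 2, which is harmless
  because \<open>output_word\<close> only distinguishes zero from nonzero.\<close>

definition arc_exp :: exp where
  "arc_exp = Add (adj_exp (V ''u'') (V ''v''))
     (Sub (Num 1) (Add (Add (nt_exp (V ''u'')) (nt_exp (V ''v'')))
       (Sub (Num 1) (Add (Sub (V ''u'') (V ''v'')) (Sub (V ''v'') (V ''u''))))))"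

definition write_kernel :: com where
  "write_kernel =
     Seq (for_kept ''u'' (emit (Num 1)))
    (Seq (emit (Num 0))
    (Seq (for_kept ''u'' (for_kept ''v'' (emit arc_exp)))
         (for_kept ''u'' (emit (nt_exp (V ''u''))))))"

definition kernelize :: com where
  "kernelize =
     Seq read_size (Seq index_input (Seq auction (Seq count_matched (Seq top_up write_kernel))))"

lemma output_word_emit:
  "output_word (s(''out'' := (s ''out'')(s ''outlen'' 0 := v),
      ''outlen'' := (s ''outlen'')(0 := Suc (s ''outlen'' 0)))) = output_word s @ [v \<noteq> 0]"
  by (simp add: output_word_def)

lemma output_word_upd:
  "x \<noteq> ''out'' \<Longrightarrow> x \<noteq> ''outlen'' \<Longrightarrow> output_word (s(x := f)) = output_word s"
  by (simp add: output_word_def)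

text \<open>Polymorphic, so that the same formula serves as a number and as a polynomial. The
  nesting follows the sequence of program phases, with \<open>m\<close> for the number of vertices
  and \<open>l\<close> for the input length.\<close>

definition kernel_time :: "'a \<Rightarrow> 'a \<Rightarrow> 'a::comm_semiring_1" where
  "kernel_time m l =
     (m * 2 + 1) + ((m * 5 + 3) +
     ((4 * l * (m * ((m + m + 1) * ((m + m) * 7 + 4) + 4) + 4) + 2) +
     ((m * 4 + 2) + ((m * 5 + 2) + (m * (m * 5 + 15) + 8)))))"

lemma poly_kernel_time:
  fixes x :: nat
  shows "poly (kernel_time [:0, 1:] [:0, 1:]) x = kernel_time x x"
  by (simp add: kernel_time_def)

lemma kernel_time_mono: "m \<le> m' \<Longrightarrow> kernel_time m l \<le> (kernel_time m' l :: nat)"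
  unfolding kernel_time_def by (intro add_mono mult_mono) simp_all

text \<open>The program is verified against the word alone; graphs return only when the output is
  interpreted.\<close>

locale input_word =
  fixes w :: "bool list" and n :: nat
  assumes n: "0 < n"
    and len: "length w = n + 1 + n * n + n"
    and size_prefix: "\<And>i. i < n \<Longrightarrow> w ! i" "\<not> w ! n"
begin

definition adj :: "nat \<Rightarrow> nat \<Rightarrow> bool" where
  "adj i j \<longleftrightarrow> w ! (n + 1 + i * n + j)"

definition nt :: "nat \<Rightarrow> bool" where
  "nt i \<longleftrightarrow> w ! (n + 1 + n * n + i)"

definition indexed :: "store \<Rightarrow> bool" where
  "indexed s \<longleftrightarrow> s ''in'' = input_store w ''in'' \<and> s ''inlen'' 0 = length w \<and> s ''n'' 0 = n \<and>
     (\<forall>i\<le>n. s ''row'' i = n + 1 + i * n) \<and> (\<forall>j<n + n. s ''vx'' j = j mod n)"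

text \<open>Indexing leaves these arrays at zero, which is a legal start of the auction: all slots
  free, all prices zero.\<close>

definition fresh :: "store \<Rightarrow> bool" where
  "fresh s \<longleftrightarrow> (\<forall>x\<in>{''h'', ''own'', ''mt'', ''c'', ''outlen''}. s x = (\<lambda>_. 0))"

lemma indexed_upd [simp]:
  assumes "x \<notin> {''in'', ''inlen'', ''n'', ''row'', ''vx''}"
  shows "indexed (s(x := f)) = indexed s"
proof -
  have "''in'' \<noteq> x" "''inlen'' \<noteq> x" "''n'' \<noteq> x" "''row'' \<noteq> x" "''vx'' \<noteq> x"
    using assms by blast+
  then show ?thesis
    unfolding indexed_def by (simp only: fun_upd_apply if_False)
qed

lemma fresh_upd [simp]:
  assumes "x \<notin> {''h'', ''own'', ''mt'', ''c'', ''outlen''}"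
  shows "fresh (s(x := f)) = fresh s"
  using assms unfolding fresh_def by (metis fun_upd_apply)

lemma indexed_simps:
  assumes "indexed s"
  shows "s ''n'' 0 = n" "s ''inlen'' 0 = length w"
    and "j < n + n \<Longrightarrow> s ''vx'' j = j mod n"
    and "i < n \<Longrightarrow> j < n \<Longrightarrow> s ''in'' (s ''row'' i + j) = of_bool (adj i j)"
    and "j < n \<Longrightarrow> s ''in'' (s ''row'' n + j) = of_bool (nt j)"
proof -
  show "s ''n'' 0 = n" "s ''inlen'' 0 = length w" "j < n + n \<Longrightarrow> s ''vx'' j = j mod n"
    using assms by (auto simp: indexed_def)
  show "s ''in'' (s ''row'' i + j) = of_bool (adj i j)" if "i < n" "j < n"
  proof -
    have "Suc i * n \<le> n * n"
      using that(1) by (intro mult_right_mono) auto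
    then have "n + 1 + i * n + j < length w"
      using that(2) by (simp add: len)
    then show ?thesis
      using assms that by (simp add: indexed_def input_store_def adj_def)
  qed
  show "s ''in'' (s ''row'' n + j) = of_bool (nt j)" if "j < n"
    using assms that by (simp add: indexed_def input_store_def nt_def len)
qed

lemma wp_read_size:
  "wp read_size (input_store w) (\<lambda>s. s = (input_store w)(''n'' := (\<lambda>_. 0)(0 := n))) (n * 2 + 1)"
proof -
  have "wp read_size (input_store w) (\<lambda>s. s = (input_store w)(''n'' := (\<lambda>_. 0)(0 := n)))
      (n * (1 + 1) + 1)"
    unfolding read_size_def
  proof (rule wp_While[where I = "\<lambda>k s. s = (input_store w)(''n'' := (\<lambda>_. 0)(0 := k))"])
    show "input_store w = (input_store w)(''n'' := (\<lambda>_. 0)(0 := 0))"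
      by (auto simp: input_store_def fun_eq_iff)
  qed (use size_prefix len in \<open>auto simp: input_store_def fun_eq_iff\<close>)
  then show ?thesis
    by (simp only: one_add_one)
qed

lemma wp_index_input:
  "wp index_input ((input_store w)(''n'' := (\<lambda>_. 0)(0 := n))) (\<lambda>s. indexed s \<and> fresh s)
     (n * 5 + 3)"
  unfolding index_input_def
proof (simp, rule wp_For[where m = n and T = 3 and
      I = "\<lambda>i s. s ''in'' = input_store w ''in'' \<and> s ''inlen'' 0 = length w \<and> s ''n'' 0 = n \<and>
        (\<forall>k\<le>i. s ''row'' k = n + 1 + k * n) \<and>
        (\<forall>k<i. s ''vx'' k = k \<and> s ''vx'' (k + n) = k) \<and> fresh s"], goal_cases)
  case 1
  then show ?case
    by (simp add: input_store_def fresh_def fun_eq_iff)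
next
  case (2 i s)
  then show ?case
    by (auto simp: less_Suc_eq le_Suc_eq)
next
  case (4 s)
  then have vx: "s ''vx'' k = k" "s ''vx'' (k + n) = k" if "k < n" for k
    using that by auto
  have "s ''vx'' j = j mod n" if "j < n + n" for j
  proof (cases "j < n")
    case False
    then have "j mod n = j - n"
      using that by (simp add: mod_if)
    then show ?thesis
      using vx(2)[of "j - n"] that False by simp
  qed (use vx in simp)
  with 4 show ?case
    by (simp add: indexed_def)
qed simp_all

section \<open>Correctness and duration of the auction\<close>

definition bid_rel :: "nat \<Rightarrow> nat \<Rightarrow> bool" where
  "bid_rel b s \<longleftrightarrow> 0 < b \<and> b \<le> n \<and> \<not> nt (b - 1) \<and> nt (s mod n) \<and> adj (b - 1) (s mod n)"

text \<open>Limited to the first \<open>m\<close> terminals, so that it can be built up bidder by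
  bidder within a round.\<close>

definition losers_done :: "nat \<Rightarrow> (nat \<Rightarrow> nat) \<Rightarrow> (nat \<Rightarrow> nat) \<Rightarrow> bool" where
  "losers_done m h mt \<longleftrightarrow>
     (\<forall>b<m. mt (Suc b) = 0 \<longrightarrow> (\<forall>s<n + n. bid_rel (Suc b) s \<longrightarrow> n + n + 1 \<le> h s))"

text \<open>Each round raises the sum of the prices, unless the auction is over.\<close>

definition progress :: "nat \<Rightarrow> nat \<Rightarrow> (nat \<Rightarrow> nat) \<Rightarrow> (nat \<Rightarrow> nat) \<Rightarrow> bool" where
  "progress t b h mt \<longleftrightarrow>
     (t \<le> sum h {..<n + n} \<and> (t < sum h {..<n + n} \<or> losers_done b h mt)) \<or> losers_done n h mt"

definition round_inv :: "nat \<Rightarrow> nat \<Rightarrow> store \<Rightarrow> bool" where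
  "round_inv t b s \<longleftrightarrow>
     indexed s \<and> s ''c'' 0 = 0 \<and> s ''outlen'' 0 = 0 \<and>
     auction_inv bid_rel (n + n) (s ''h'') (s ''own'') (s ''mt'') \<and>
     progress t b (s ''h'') (s ''mt'') \<and> (\<forall>j<n + n. s ''h'' j \<le> n + n + 1)"

text \<open>Prices are tried in increasing order, and at price \<open>d\<close> the slots before
  \<open>j\<close> have been scanned. So as long as the bidder is unmatched, those cost more than
  \<open>d\<close> and the others at least \<open>d\<close>.\<close>

definition cheapest :: "nat \<Rightarrow> nat \<Rightarrow> nat \<Rightarrow> store \<Rightarrow> bool" where
  "cheapest b d j s \<longleftrightarrow> (s ''mt'' (Suc b) = 0 \<longrightarrow>
     (\<forall>k<n + n. bid_rel (Suc b) k \<longrightarrow> d + of_bool (k < j) \<le> s ''h'' k))"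

lemma round_inv_upd [simp]:
  "x \<in> {''t'', ''b'', ''d'', ''s''} \<Longrightarrow> round_inv t b (s(x := f)) = round_inv t b s"
  by (elim insertE emptyE) (simp_all add: round_inv_def)

lemma cheapest_upd [simp]:
  "x \<in> {''t'', ''b'', ''d'', ''s''} \<Longrightarrow> cheapest b d j (s(x := f)) = cheapest b d j s"
  by (elim insertE emptyE) (simp_all add: cheapest_def)

text \<open>A bid happens only at price \<open>d\<close>, and \<open>cheapest\<close> makes that
  price minimal. Afterwards the bidder is matched and \<open>cheapest\<close> holds vacuously;
  without a bid, slot \<open>j\<close> is seen not to have price \<open>d\<close> if the bidder
  wants it and is unmatched.\<close>

lemma wp_bid:
  assumes inv: "round_inv t b s" "cheapest b d j s" and bound: "b < n" "d < n + n + 1" "j < n + n"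
    and counters: "s ''t'' 0 = t" "s ''b'' 0 = b" "s ''d'' 0 = d" "s ''s'' 0 = j"
  shows "wp bid s (\<lambda>s. round_inv t b s \<and> cheapest b d (Suc j) s \<and>
    s ''t'' 0 = t \<and> s ''b'' 0 = b \<and> s ''d'' 0 = d \<and> s ''s'' 0 = j) 5"
proof -
  have idx: "indexed s"
    using inv(1) by (simp add: round_inv_def)
  have jn: "j mod n < n"
    using n by simp
  note simps = indexed_simps(1,3-5)[OF idx]
  define cond where "cond \<longleftrightarrow> bid_rel (Suc b) j \<and> s ''mt'' (Suc b) = 0 \<and> s ''h'' j = d"
  define e where "e = Sub (Add (adj_exp (V ''b'') (Get ''vx'' (V ''s''))) (nt_exp (Get ''vx'' (V ''s''))))
        (Add (Num 1) (Add (nt_exp (V ''b'')) (Add (Get ''mt'' (Add (V ''b'') (Num 1)))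
          (Add (Sub (V ''d'') (Get ''h'' (V ''s''))) (Sub (Get ''h'' (V ''s'')) (V ''d''))))))"
  have val_e: "val e s = of_bool (adj b (j mod n)) + of_bool (nt (j mod n)) -
      Suc (of_bool (nt b) + (s ''mt'' (Suc b) + ((d - s ''h'' j) + (s ''h'' j - d))))"
    unfolding e_def adj_exp_def nt_exp_def val.simps simps(1) counters simps(2)[OF bound(3)]
      simps(3)[OF bound(1) jn] simps(4)[OF jn] simps(4)[OF bound(1)]
    by simp
  have eq: "of_bool A + of_bool B - Suc (of_bool C + (m + ((d - h) + (h - d)))) \<noteq> 0 \<longleftrightarrow>
      A \<and> B \<and> \<not> C \<and> m = 0 \<and> h = d" for A B C and m h :: nat
    by (cases A; cases B; cases C) (simp_all, arith?)
  have cond: "val e s \<noteq> 0 \<longleftrightarrow> cond"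
    unfolding val_e eq cond_def bid_rel_def using bound(1) by auto
  show ?thesis
  proof (cases cond)
    case False
    have "cheapest b d (Suc j) s"
      unfolding cheapest_def
    proof (intro impI allI)
      fix k
      assume k: "s ''mt'' (Suc b) = 0" "k < n + n" "bid_rel (Suc b) k"
      then have "d + of_bool (k < j) \<le> s ''h'' k"
        using inv(2) by (simp add: cheapest_def)
      moreover have "k = j \<Longrightarrow> s ''h'' k \<noteq> d"
        using False k by (auto simp: cond_def)
      ultimately show "d + of_bool (k < Suc j) \<le> s ''h'' k"
        by (cases "k = j") (auto simp: less_Suc_eq)
    qed
    then show ?thesis
      unfolding bid_def e_def[symmetric] wp_If cond using False inv counters by simp
  next
    case True
    let ?h = "(s ''h'')(j := Suc (s ''h'' j))" and ?own = "(s ''own'')(j := Suc b)"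
      and ?mt = "(s ''mt'')(s ''own'' j := 0, Suc b := Suc 0)"
    have b: "bid_rel (Suc b) j" "s ''mt'' (Suc b) = 0" "s ''h'' j = d"
      using True by (auto simp: cond_def)
    have "auction_inv bid_rel (n + n) ?h ?own ?mt"
    proof (rule auction_inv_bid)
      show "s ''h'' j \<le> s ''h'' k" if "k < n + n" "bid_rel (Suc b) k" for k
        using inv(2) that b(2,3) by (auto simp: cheapest_def)
    qed (use inv(1) b bound in \<open>auto simp: round_inv_def\<close>)
    \<comment> \<open>An unmatched bidder facing a price below \<open>2n + 1\<close> shows that the
      auction is not over, so the price sum was at least \<open>t\<close> and now exceeds it. This
      covers the case that the displaced holder spoils \<open>losers_done b\<close>.\<close>
    moreover have "progress t b ?h ?mt"
    proof -
      have "\<not> n + n + 1 \<le> s ''h'' j"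
        using b(3) bound(2) by simp
      then have "\<not> losers_done n (s ''h'') (s ''mt'')"
        using b(1,2) bound(1,3) unfolding losers_done_def by blast
      moreover have "sum ?h {..<n + n} = Suc (sum (s ''h'') {..<n + n})"
        using bound(3) by (subst (1 2) sum.remove[of _ j]) auto
      ultimately show ?thesis
        using inv(1) by (auto simp: round_inv_def progress_def)
    qed
    moreover have "\<forall>k<n + n. ?h k \<le> n + n + 1"
      using inv(1) b(3) bound(2) by (simp add: round_inv_def)
    ultimately have "round_inv t b (s(''mt'' := ?mt, ''own'' := ?own, ''h'' := ?h))"
      using inv(1) by (simp add: round_inv_def)
    moreover have "s(''mt'' := (s ''mt'')(s ''own'' j := 0), ''own'' := ?own, ''mt'' := ?mt, ''h'' := ?h)
        = s(''mt'' := ?mt, ''own'' := ?own, ''h'' := ?h)"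
      by (simp add: fun_eq_iff)
    ultimately show ?thesis
      unfolding bid_def e_def[symmetric] wp_If cond using True b(3) by (simp add: counters cheapest_def)
  qed
qed

text \<open>The loops are treated from the inside out: slots, prices, bidders, rounds. At the end of
  round \<open>t\<close> either the price sum exceeds \<open>t\<close> or all losers are
  done.\<close>

lemma wp_auction:
  assumes s0: "indexed s0" "fresh s0"
  shows "wp auction s0 (\<lambda>s. indexed s \<and> s ''c'' 0 = 0 \<and> s ''outlen'' 0 = 0 \<and>
      auction_inv bid_rel (n + n) (s ''h'') (s ''own'') (s ''mt'') \<and>
      losers_done n (s ''h'') (s ''mt''))
    (4 * length w * (n * ((n + n + 1) * ((n + n) * 7 + 4) + 4) + 4) + 2)"
proof -
  have slots: "wp (For ''s'' (Add (V ''n'') (V ''n'')) bid) s (\<lambda>s. round_inv t b s \<and>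
      cheapest b (Suc d) 0 s \<and> s ''t'' 0 = t \<and> s ''b'' 0 = b \<and> s ''d'' 0 = d) ((n + n) * 7 + 2)"
    if "round_inv t b s" "cheapest b d 0 s" "b < n" "d < n + n + 1"
      "s ''t'' 0 = t" "s ''b'' 0 = b" "s ''d'' 0 = d" for t b d s
  proof (rule wp_For[where m = "n + n" and T = 5 and I = "\<lambda>j s. round_inv t b s \<and>
      cheapest b d j s \<and> s ''t'' 0 = t \<and> s ''b'' 0 = b \<and> s ''d'' 0 = d"], goal_cases)
    case (2 j s)
    then show ?case
      using that by (intro wp_mono[OF wp_bid[of t b s d j]]) auto
  next
    case (4 s)
    then show ?case
      by (auto simp: cheapest_def)
  qed (use that in \<open>auto simp: round_inv_def indexed_simps\<close>)
  have prices: "wp (For ''d'' (Add (Add (V ''n'') (V ''n'')) (Num 1))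
        (For ''s'' (Add (V ''n'') (V ''n'')) bid)) s
      (\<lambda>s. round_inv t (Suc b) s \<and> s ''t'' 0 = t \<and> s ''b'' 0 = b)
      ((n + n + 1) * ((n + n) * 7 + 4) + 2)"
    if "round_inv t b s" "b < n" "s ''t'' 0 = t" "s ''b'' 0 = b" for t b s
  proof (rule wp_For[where m = "n + n + 1" and T = "(n + n) * 7 + 2" and I = "\<lambda>d s.
      round_inv t b s \<and> cheapest b d 0 s \<and> s ''t'' 0 = t \<and> s ''b'' 0 = b"], goal_cases)
    case (2 d s)
    then show ?case
      using that by (intro wp_mono[OF slots[of t b s d]]) auto
  next
    \<comment> \<open>All prices up to \<open>2n\<close> have been tried, so bidder \<open>b\<close>
      is matched or its adjacent slots cost at least \<open>2n + 1\<close>.\<close>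
    case (4 s)
    then have "progress t (Suc b) (s ''h'') (s ''mt'')"
      by (auto simp: round_inv_def progress_def losers_done_def cheapest_def less_Suc_eq)
    with 4 show ?case
      by (simp add: round_inv_def)
  next
    case 5
    show ?case
      by (simp add: algebra_simps)
  qed (use that in \<open>auto simp: round_inv_def indexed_simps cheapest_def\<close>)
  have round: "wp (For ''b'' (V ''n'') (For ''d'' (Add (Add (V ''n'') (V ''n'')) (Num 1))
        (For ''s'' (Add (V ''n'') (V ''n'')) bid))) s
      (\<lambda>s. round_inv (Suc t) 0 s \<and> s ''t'' 0 = t)
      (n * ((n + n + 1) * ((n + n) * 7 + 4) + 4) + 2)"
    if "round_inv t 0 s" "s ''t'' 0 = t" for t s
  proof (rule wp_For[where m = n and T = "(n + n + 1) * ((n + n) * 7 + 4) + 2" and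
      I = "\<lambda>b s. round_inv t b s \<and> s ''t'' 0 = t"], goal_cases)
    case (2 b s)
    then show ?case
      using that by (intro wp_mono[OF prices[of t b s]]) auto
  next
    case (4 s)
    then have "progress (Suc t) 0 (s ''h'') (s ''mt'')"
      by (auto simp: round_inv_def progress_def losers_done_def)
    with 4 show ?case
      by (simp add: round_inv_def)
  next
    case 5
    show ?case
      by (simp add: algebra_simps)
  qed (use that in \<open>auto simp: round_inv_def indexed_simps\<close>)
  show ?thesis
    unfolding auction_def
  proof (rule wp_For[where m = "4 * length w" and
      T = "n * ((n + n + 1) * ((n + n) * 7 + 4) + 4) + 2" and I = "\<lambda>t s. round_inv t 0 s"],
      goal_cases)
    case 1
    then show ?case
      using s0 by (simp add: round_inv_def fresh_def auction_inv_def progress_def losers_done_def)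
  next
    case (2 t s)
    then show ?case
      by (intro wp_mono[OF round[of t s]]) auto
  next
    \<comment> \<open>If the auction were not over, the price sum would be at least the number of
      rounds, contrary to the cap on the prices.\<close>
    case (4 s)
    then have "sum (s ''h'') {..<n + n} \<le> (n + n) * (n + n + 1)"
      using sum_bounded_above[of "{..<n + n}" "s ''h''" "n + n + 1"] by (simp add: round_inv_def)
    also have "\<dots> < 4 * length w"
      by (simp add: len algebra_simps)
    finally show ?case
      using 4 by (auto simp: round_inv_def progress_def)
  next
    case 5
    show ?case
      by (simp add: algebra_simps)
  qed (auto simp: round_inv_def indexed_simps)
qed

section \<open>From the auction to a cover by stars\<close>

definition matched :: "(nat \<Rightarrow> nat) \<Rightarrow> nat set" where
  "matched mt = {i. i < n \<and> mt (Suc i) \<noteq> 0}"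

lemma finite_matched [simp]: "finite (matched mt)"
  by (simp add: matched_def)

lemma matched_upd: "i < n \<Longrightarrow> matched (mt(Suc i := Suc 0)) = insert i (matched mt)"
  by (auto simp: matched_def)

text \<open>The counterpart of \<open>expansion\<close> for vertex indices, with the arcs read from
  the input word.\<close>

definition star_cover :: "nat set \<Rightarrow> nat rel \<Rightarrow> bool" where
  "star_cover K P \<longleftrightarrow>
     (\<forall>(b, a)\<in>P. b \<in> K \<and> a < n \<and> nt a \<and> adj b a) \<and> single_valued P \<and>
     (\<forall>a\<in>Range P. 2 \<le> card (P\<inverse> `` {a})) \<and>
     (\<forall>b<n. \<not> nt b \<longrightarrow> b \<notin> K \<or> b \<in> Domain P \<longrightarrow> (\<forall>a<n. nt a \<longrightarrow> adj b a \<longrightarrow> a \<in> Range P))"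

lemma star_cover_mono: "star_cover K P \<Longrightarrow> K \<subseteq> K' \<Longrightarrow> star_cover K' P"
  unfolding star_cover_def by blast

text \<open>Every matched terminal holds a slot of a non-terminal, each slot has one holder, and a
  non-terminal has two slots.\<close>

lemma matched_auction:
  assumes inv: "auction_inv bid_rel (n + n) h own mt"
  shows "matched mt \<subseteq> {i. i < n \<and> \<not> nt i}" "card (matched mt) \<le> 2 * card {i. i < n \<and> nt i}"
proof -
  have held: "\<exists>s<n + n. own s = Suc i \<and> bid_rel (Suc i) s" if "i \<in> matched mt" for i
    using inv that unfolding auction_inv_def matched_def
    by (metis (mono_tags, lifting) mem_Collect_eq nat.distinct(1))
  then show "matched mt \<subseteq> {i. i < n \<and> \<not> nt i}"
    by (fastforce simp: bid_rel_def matched_def)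
  let ?A = "{i. i < n \<and> nt i}"
  have "Suc ` matched mt \<subseteq> own ` (?A \<union> (\<lambda>i. i + n) ` ?A)"
  proof
    fix b
    assume "b \<in> Suc ` matched mt"
    then obtain s where s: "s < n + n" "own s = b" "nt (s mod n)"
      using held by (fastforce simp: bid_rel_def)
    have "s \<in> ?A \<union> (\<lambda>i. i + n) ` ?A"
    proof (cases "s < n")
      case False
      then have "s mod n = s - n"
        using s(1) by (simp add: mod_if)
      then show ?thesis
        using s False by (intro UnI2 image_eqI[of _ _ "s - n"]) auto
    qed (use s in auto)
    with s(2) show "b \<in> own ` (?A \<union> (\<lambda>i. i + n) ` ?A)"
      by blast
  qed
  then have "card (Suc ` matched mt) \<le> card (?A \<union> (\<lambda>i. i + n) ` ?A)"
    by (intro surj_card_le) auto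
  also have "\<dots> \<le> card ?A + card ((\<lambda>i. i + n) ` ?A)"
    by (rule card_Un_le)
  also have "\<dots> \<le> 2 * card ?A"
    using card_image_le[of ?A "\<lambda>i. i + n"] by simp
  finally show "card (matched mt) \<le> 2 * card ?A"
    by (simp add: card_image)
qed

lemma star_cover_auction:
  assumes inv: "auction_inv bid_rel (n + n) h own mt" and losers: "losers_done n h mt"
  shows "\<exists>P. star_cover (matched mt) P"
proof -
  obtain X where X: "X \<subseteq> {..<n + n}" "\<And>s. s \<in> X \<Longrightarrow> own s \<noteq> 0"
    and closed: "\<And>b s. b \<noteq> 0 \<Longrightarrow> mt b = 0 \<or> b \<in> own ` X \<Longrightarrow> s < n + n \<Longrightarrow> bid_rel b s \<Longrightarrow> s \<in> X"
  proof (rule auction_closed_slots[OF inv, of "n + n + 1"])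
    show "n + n + 1 \<le> h s" if "b \<noteq> 0" "mt b = 0" "s < n + n" "bid_rel b s" for b s
      using losers that by (cases b) (auto simp: losers_done_def bid_rel_def Suc_le_eq)
  qed auto
  have own: "bid_rel (own s) s" "mt (own s) \<noteq> 0" if "s \<in> X" for s
    using inv X that unfolding auction_inv_def by (metis lessThan_iff subsetD)+
  have inj: "s = s'" if "s \<in> X" "s' \<in> X" "own s = own s'" for s s'
    using inv X that unfolding auction_inv_def by (metis lessThan_iff subsetD)
  \<comment> \<open>Each slot of \<open>X\<close> links the terminal of its holder to the vertex
    that the slot belongs to.\<close>
  define P where "P = (\<lambda>s. (own s - 1, s mod n)) ` X"
  have P: "b \<in> matched mt \<and> a < n \<and> nt a \<and> adj b a" if "(b, a) \<in> P" for b a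
  proof -
    obtain s where "s \<in> X" "b = own s - 1" "a = s mod n"
      using \<open>(b, a) \<in> P\<close> by (auto simp: P_def)
    with own[of s] n show ?thesis
      by (auto simp: bid_rel_def matched_def)
  qed
  have "single_valued P"
  proof (rule single_valuedI)
    fix b a a'
    assume "(b, a) \<in> P" "(b, a') \<in> P"
    then obtain s s' where "s \<in> X" "s' \<in> X" "b = own s - 1" "b = own s' - 1" "a = s mod n" "a' = s' mod n"
      by (auto simp: P_def)
    moreover from this have "own s = own s'"
      using X(2)[of s] X(2)[of s'] by simp
    ultimately show "a = a'"
      using inj by blast
  qed
  moreover have "2 \<le> card (P\<inverse> `` {a})" if "a \<in> Range P" for a
  proof -
    obtain s where s: "s \<in> X" "a = s mod n"
      using \<open>a \<in> Range P\<close> by (auto simp: P_def)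
    have "a < n"
      using s n by simp
    \<comment> \<open>Both slots of a vertex attract the same bidders, so the holder of one is
      adjacent to the other, and closure puts both into \<open>X\<close>. This yields the two
      leaves.\<close>
    have in_X: "s' \<in> X" if "s' < n + n" "s' mod n = a" for s'
      using closed[of "own s" s'] own(1)[OF s(1)] X(2)[OF s(1)] s that by (auto simp: bid_rel_def)
    then have both: "a \<in> X" "a + n \<in> X"
      using \<open>a < n\<close> by simp_all
    then have "own a \<noteq> own (a + n)"
      using inj n by fastforce
    then have "own a - 1 \<noteq> own (a + n) - 1"
      using X(2)[OF both(1)] X(2)[OF both(2)] by simp
    moreover have "{own a - 1, own (a + n) - 1} \<subseteq> P\<inverse> `` {a}"
      using both \<open>a < n\<close> by (force simp: P_def)
    moreover have "P\<inverse> `` {a} \<subseteq> matched mt"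
      using P by blast
    then have "finite (P\<inverse> `` {a})"
      by (rule finite_subset) simp
    ultimately show ?thesis
      by (metis card_2_iff card_mono)
  qed
  moreover have "a \<in> Range P"
    if "b < n" "\<not> nt b" "b \<notin> matched mt \<or> b \<in> Domain P" "a < n" "nt a" "adj b a" for b a
  proof -
    have "mt (Suc b) = 0 \<or> Suc b \<in> own ` X"
      using that(1,3) X(2) by (force simp: matched_def P_def)
    moreover have "bid_rel (Suc b) a"
      using that by (simp add: bid_rel_def)
    ultimately have "a \<in> X"
      using closed[of "Suc b" a] that(4) by simp
    then have "(own a - 1, a mod n) \<in> P"
      by (auto simp: P_def)
    with that(4) show ?thesis
      by auto
  qed
  ultimately have "star_cover (matched mt) P"
    unfolding star_cover_def using P by blast
  then show ?thesis ..
qed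

section \<open>Counting and completing the kept terminals\<close>

lemma wp_count_matched:
  assumes "indexed s0" "s0 ''c'' 0 = 0" "s0 ''outlen'' 0 = 0" "s0 ''mt'' = mt"
  shows "wp count_matched s0 (\<lambda>s. indexed s \<and> s ''outlen'' 0 = 0 \<and> s ''mt'' = mt \<and>
    s ''c'' 0 = card (matched mt)) (n * 4 + 2)"
  unfolding count_matched_def
proof (rule wp_For[where m = n and T = 2 and I = "\<lambda>i s. indexed s \<and> s ''outlen'' 0 = 0 \<and>
    s ''mt'' = mt \<and> s ''c'' 0 = card {k. k < i \<and> mt (Suc k) \<noteq> 0}"], goal_cases)
  case (2 i s)
  have "{k. k < Suc i \<and> mt (Suc k) \<noteq> 0} =
      (if mt (Suc i) \<noteq> 0 then insert i {k. k < i \<and> mt (Suc k) \<noteq> 0}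
       else {k. k < i \<and> mt (Suc k) \<noteq> 0})"
    by (auto simp: less_Suc_eq)
  then show ?case
    using 2 by simp
qed (use assms in \<open>simp_all add: indexed_simps matched_def\<close>)

text \<open>Terminals are added only while fewer than two are kept, so the count never passes the
  larger of two and its start. If it stayed below two, every terminal would have been kept, and
  there are at least two.\<close>

lemma wp_top_up:
  assumes s0: "indexed s0" "s0 ''outlen'' 0 = 0" "s0 ''mt'' = mt" "s0 ''c'' 0 = card (matched mt)"
    and terminals: "matched mt \<subseteq> {i. i < n \<and> \<not> nt i}" "2 \<le> card {i. i < n \<and> \<not> nt i}"
  shows "wp top_up s0 (\<lambda>s. indexed s \<and> s ''outlen'' 0 = 0 \<and> matched mt \<subseteq> matched (s ''mt'') \<and>
      matched (s ''mt'') \<subseteq> {i. i < n \<and> \<not> nt i} \<and> 2 \<le> card (matched (s ''mt'')) \<and>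
      card (matched (s ''mt'')) \<le> max 2 (card (matched mt))) (n * 5 + 2)"
  unfolding top_up_def
proof (rule wp_For[where m = n and T = 3 and I = "\<lambda>i s. indexed s \<and> s ''outlen'' 0 = 0 \<and>
      s ''c'' 0 = card (matched (s ''mt'')) \<and>
      matched mt \<subseteq> matched (s ''mt'') \<and> matched (s ''mt'') \<subseteq> {i. i < n \<and> \<not> nt i} \<and>
      card (matched (s ''mt'')) \<le> max 2 (card (matched mt)) \<and>
      (2 \<le> card (matched (s ''mt'')) \<or> (\<forall>k<i. \<not> nt k \<longrightarrow> k \<in> matched (s ''mt'')))"], goal_cases)
  case 1
  then show ?case
    using s0 terminals by simp
next
  case (2 i s)
  let ?e = "Sub (Num 2) (Add (V ''c'') (Add (Add (nt_exp (V ''i'')) (nt_exp (V ''i'')))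
           (Add (Get ''mt'' (Add (V ''i'') (Num 1))) (Get ''mt'' (Add (V ''i'') (Num 1))))))"
  \<comment> \<open>Both flags enter twice, so that either of them alone brings the truncated
    difference down to zero.\<close>
  have val_e: "val ?e s = 2 - (card (matched (s ''mt'')) +
      (of_bool (nt i) + of_bool (nt i) + (s ''mt'' (Suc i) + s ''mt'' (Suc i))))"
    using 2 indexed_simps(1,5)[of s] by (simp add: nt_exp_def adj_exp_def)
  show ?case
  proof (cases "card (matched (s ''mt'')) < 2 \<and> \<not> nt i \<and> i \<notin> matched (s ''mt'')")
    case True
    then have "val ?e s \<noteq> 0"
      unfolding val_e using 2(1) by (simp add: matched_def)
    then show ?thesis
      unfolding wp_If using 2 True by (auto simp: matched_upd less_Suc_eq)
  next
    case False
    then have "val ?e s = 0"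
      unfolding val_e using 2(1) by (auto simp: matched_def)
    then show ?thesis
      unfolding wp_If using 2 False by (auto simp: less_Suc_eq)
  qed
next
  case (3 i s)
  then show ?case
    by (simp add: indexed_simps)
next
  case (4 s)
  have "2 \<le> card (matched (s ''mt''))"
  proof (rule ccontr)
    assume "\<not> 2 \<le> card (matched (s ''mt''))"
    then have "{i. i < n \<and> \<not> nt i} \<subseteq> matched (s ''mt'')"
      using 4 by blast
    then have "2 \<le> card (matched (s ''mt''))"
      using terminals(2) card_mono[OF finite_matched] by (meson le_trans)
    then show False
      using \<open>\<not> 2 \<le> card (matched (s ''mt''))\<close> by simp
  qed
  with 4 show ?case
    by simp
next
  case 5
  show ?case
    by simp
qed

section \<open>Writing the kernel\<close>

definition kept :: "nat set \<Rightarrow> nat list" where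
  "kept K = filter (\<lambda>i. nt i \<or> i \<in> K) [0..<n]"

definition kernel_arc :: "nat \<Rightarrow> nat \<Rightarrow> bool" where
  "kernel_arc u v \<longleftrightarrow> adj u v \<or> (\<not> nt u \<and> \<not> nt v \<and> u \<noteq> v)"

definition kernel_word :: "nat set \<Rightarrow> bool list" where
  "kernel_word K = replicate (length (kept K)) True @ [False] @
     concat (map (\<lambda>u. map (kernel_arc u) (kept K)) (kept K)) @ map nt (kept K)"

text \<open>The invariant speaks of the list of kept vertices visited so far. Its stability under
  all updates of \<open>x\<close> absorbs the loop counter.\<close>

lemma wp_for_kept:
  assumes init: "I [] s"
    and stable: "\<And>l s f. I l s \<Longrightarrow> I l (s(x := f))"
    and inv: "\<And>l s. I l s \<Longrightarrow> indexed s \<and> matched (s ''mt'') = K"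
    and body: "\<And>l i s. i < n \<Longrightarrow> s x 0 = i \<Longrightarrow> I l s \<Longrightarrow>
      wp c s (\<lambda>s. s x 0 = i \<and> I (l @ [i]) s) T"
    and T: "1 \<le> T"
  shows "wp (for_kept x c) s (I (kept K)) (n * (T + 3) + 2)"
  unfolding for_kept_def
proof (rule wp_For[where m = n and T = "T + 1" and
      I = "\<lambda>i s. I (filter (\<lambda>i. nt i \<or> i \<in> K) [0..<i]) s"], goal_cases)
  case 1
  then show ?case
    using stable[OF init] by simp
next
  case (2 i s)
  have mt: "s ''mt'' (Suc i) \<noteq> 0 \<longleftrightarrow> i \<in> K"
    using inv[OF 2(3)] 2(1) by (auto simp: matched_def)
  have "val (nt_exp (V x)) s = of_bool (nt i)"
    using inv[OF 2(3)] 2 indexed_simps(1,5)[of s] by (simp add: nt_exp_def adj_exp_def)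
  then have cond: "val (Add (nt_exp (V x)) (Get ''mt'' (Add (V x) (Num 1)))) s \<noteq> 0 \<longleftrightarrow> nt i \<or> i \<in> K"
    using 2(2) mt by simp
  show ?case
  proof (cases "nt i \<or> i \<in> K")
    case True
    have "wp c s (\<lambda>s. s x 0 = i \<and>
        I (filter (\<lambda>i. nt i \<or> i \<in> K) [0..<Suc i]) (s(x := (s x)(0 := Suc i)))) T"
      by (rule wp_mono[OF body[OF 2]]) (use stable True in auto)
    with True show ?thesis
      unfolding wp_If cond by simp
  next
    case False
    with stable[OF 2(3)] T show ?thesis
      unfolding wp_If cond using 2(2) by simp
  qed
next
  case (3 i s)
  then show ?case
    using inv by (auto simp: indexed_simps)
next
  case (4 s)
  then show ?case
    by (simp add: kept_def)
next
  case 5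
  show ?case
    by (simp add: algebra_simps)
qed

lemma wp_emit:
  assumes "indexed s"
  shows "wp (emit e) s (\<lambda>s'. indexed s' \<and> s' ''mt'' = s ''mt'' \<and>
      output_word s' = output_word s @ [val e s \<noteq> 0] \<and> s' ''u'' 0 = s ''u'' 0 \<and> s' ''v'' 0 = s ''v'' 0) 2"
  using assms output_word_emit[of s "val e s"] by (simp add: emit_def)

lemma wp_write_kernel:
  assumes s0: "indexed s0" "s0 ''outlen'' 0 = 0" "matched (s0 ''mt'') = K"
  shows "wp write_kernel s0 (\<lambda>s. output_word s = kernel_word K) (n * (n * 5 + 15) + 8)"
proof -
  let ?W = "\<lambda>s. indexed s \<and> matched (s ''mt'') = K"
  have header: "wp (for_kept ''u'' (emit (Num 1))) s
      (\<lambda>s. ?W s \<and> output_word s = replicate (length (kept K)) True) (n * 5 + 2)"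
    if "?W s" "output_word s = []" for s
  proof -
    have "wp (for_kept ''u'' (emit (Num 1))) s
        (\<lambda>s. ?W s \<and> output_word s = map (\<lambda>_. True) (kept K)) (n * (2 + 3) + 2)"
    proof (rule wp_for_kept[where I = "\<lambda>l s. ?W s \<and> output_word s = map (\<lambda>_. True) l"],
        goal_cases)
      case (4 l i s)
      then show ?case
        by (intro wp_mono[OF wp_emit]) auto
    qed (use that in \<open>auto simp: output_word_upd\<close>)
    then show ?thesis
      by (simp add: map_replicate_const)
  qed
  have row: "wp (for_kept ''v'' (emit arc_exp)) s
      (\<lambda>s. s ''u'' 0 = u \<and> ?W s \<and> output_word s = pre @ map (kernel_arc u) (kept K)) (n * (2 + 3) + 2)"
    if "?W s" "output_word s = pre" "s ''u'' 0 = u" "u < n" for s u pre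
  proof (rule wp_for_kept[where
        I = "\<lambda>l s. s ''u'' 0 = u \<and> ?W s \<and> output_word s = pre @ map (kernel_arc u) l"], goal_cases)
    case (4 l v s)
    then have "val arc_exp s = of_bool (adj u v) +
        (1 - (of_bool (nt u) + of_bool (nt v) + (1 - ((u - v) + (v - u)))))"
      using that(4) indexed_simps(1,4,5)[of s] by (simp add: arc_exp_def nt_exp_def adj_exp_def)
    also have "\<dots> \<noteq> 0 \<longleftrightarrow> kernel_arc u v"
      by (cases "adj u v"; cases "nt u"; cases "nt v") (auto simp: kernel_arc_def)
    finally show ?case
      using 4 by (intro wp_mono[OF wp_emit]) auto
  qed (use that in \<open>auto simp: output_word_upd\<close>)
  have rows: "wp (for_kept ''u'' (for_kept ''v'' (emit arc_exp))) s
      (\<lambda>s. ?W s \<and>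
        output_word s = pre @ concat (map (\<lambda>u. map (kernel_arc u) (kept K)) (kept K)))
      (n * ((n * (2 + 3) + 2) + 3) + 2)"
    if "?W s" "output_word s = pre" for s pre
  proof (rule wp_for_kept[where I = "\<lambda>l s. ?W s \<and>
        output_word s = pre @ concat (map (\<lambda>u. map (kernel_arc u) (kept K)) l)"], goal_cases)
    case (4 l u s)
    then show ?case
      by (intro wp_mono[OF row[of s _ u]]) auto
  qed (use that in \<open>auto simp: output_word_upd\<close>)
  have flags: "wp (for_kept ''u'' (emit (nt_exp (V ''u'')))) s
      (\<lambda>s. ?W s \<and> output_word s = pre @ map nt (kept K)) (n * (2 + 3) + 2)"
    if "?W s" "output_word s = pre" for s pre
  proof (rule wp_for_kept[where I = "\<lambda>l s. ?W s \<and> output_word s = pre @ map nt l"], goal_cases)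
    case (4 l i s)
    then have "val (nt_exp (V ''u'')) s = of_bool (nt i)"
      using indexed_simps(1,5)[of s] by (simp add: nt_exp_def adj_exp_def)
    with 4 show ?case
      by (intro wp_mono[OF wp_emit]) auto
  qed (use that in \<open>auto simp: output_word_upd\<close>)
  have "output_word s0 = []"
    using s0 by (simp add: output_word_def)
  show ?thesis
    unfolding write_kernel_def
  proof (rule wp_Seq[OF wp_mono[OF header[of s0] order_refl]])
    fix s
    assume s: "?W s \<and> output_word s = replicate (length (kept K)) True"
    show "wp (Seq (emit (Num 0)) (Seq (for_kept ''u'' (for_kept ''v'' (emit arc_exp)))
          (for_kept ''u'' (emit (nt_exp (V ''u'')))))) s (\<lambda>s. output_word s = kernel_word K)
        (2 + ((n * ((n * (2 + 3) + 2) + 3) + 2) + (n * (2 + 3) + 2)))"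
    proof (rule wp_Seq[OF wp_mono[OF wp_emit order_refl] order_refl])
      show "indexed s"
        using s by simp
    next
      fix s1
      assume "indexed s1 \<and> s1 ''mt'' = s ''mt'' \<and>
        output_word s1 = output_word s @ [val (Num 0) s \<noteq> 0] \<and>
        s1 ''u'' 0 = s ''u'' 0 \<and> s1 ''v'' 0 = s ''v'' 0"
      with s have s1: "?W s1" "output_word s1 = replicate (length (kept K)) True @ [False]"
        by simp_all
      show "wp (Seq (for_kept ''u'' (for_kept ''v'' (emit arc_exp)))
          (for_kept ''u'' (emit (nt_exp (V ''u''))))) s1 (\<lambda>s. output_word s = kernel_word K)
          ((n * ((n * (2 + 3) + 2) + 3) + 2) + (n * (2 + 3) + 2))"
        by (rule wp_Seq[OF wp_mono[OF rows[OF s1] order_refl] order_refl],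
            rule wp_mono[OF flags[OF _ refl] order_refl]) (auto simp: kernel_word_def)
    qed
  qed (use s0 \<open>output_word s0 = []\<close> in \<open>simp_all add: algebra_simps\<close>)
qed

section \<open>The complete program\<close>

definition keep_set :: "nat set \<Rightarrow> bool" where
  "keep_set K \<longleftrightarrow> K \<subseteq> {i. i < n \<and> \<not> nt i} \<and> 2 \<le> card K \<and>
     card K \<le> max 2 (2 * card {i. i < n \<and> nt i}) \<and> (\<exists>P. star_cover K P)"

lemma wp_kernelize:
  assumes terminals: "2 \<le> card {i. i < n \<and> \<not> nt i}"
  shows "wp kernelize (input_store w) (\<lambda>s. \<exists>K. keep_set K \<and> output_word s = kernel_word K)
    (kernel_time n (length w))"
  unfolding kernelize_def kernel_time_def
proof (rule wp_Seq[OF wp_mono[OF wp_read_size order_refl] order_refl], simp only:,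
    rule wp_Seq[OF wp_mono[OF wp_index_input order_refl] order_refl], elim conjE,
    rule wp_Seq[OF wp_mono[OF wp_auction order_refl] order_refl], assumption, assumption,
    elim conjE)
  fix s :: store
  define mt where "mt = s ''mt''"
  assume s: "indexed s" "s ''c'' 0 = 0" "s ''outlen'' 0 = 0"
    and inv: "auction_inv bid_rel (n + n) (s ''h'') (s ''own'') (s ''mt'')"
    and losers: "losers_done n (s ''h'') (s ''mt'')"
  have mt: "s ''mt'' = mt" "matched mt \<subseteq> {i. i < n \<and> \<not> nt i}"
      "card (matched mt) \<le> 2 * card {i. i < n \<and> nt i}"
    using matched_auction[OF inv] by (simp_all add: mt_def)
  obtain P where P: "star_cover (matched mt) P"
    using star_cover_auction[OF inv losers] by (auto simp: mt_def)
  show "wp (Seq count_matched (Seq top_up write_kernel)) s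
      (\<lambda>s. \<exists>K. keep_set K \<and> output_word s = kernel_word K)
      ((n * 4 + 2) + ((n * 5 + 2) + (n * (n * 5 + 15) + 8)))"
  proof (rule wp_Seq[OF wp_mono[OF wp_count_matched[OF s mt(1)] order_refl] order_refl], elim conjE,
      rule wp_Seq[OF wp_mono[OF wp_top_up[OF _ _ _ _ mt(2) terminals] order_refl] order_refl],
      assumption, assumption, assumption, assumption, elim conjE)
    fix s
    assume s: "indexed s" "s ''outlen'' 0 = 0" and sub: "matched mt \<subseteq> matched (s ''mt'')"
      and "matched (s ''mt'') \<subseteq> {i. i < n \<and> \<not> nt i}" "2 \<le> card (matched (s ''mt''))"
        "card (matched (s ''mt'')) \<le> max 2 (card (matched mt))"
    moreover from this have "card (matched (s ''mt'')) \<le> max 2 (2 * card {i. i < n \<and> nt i})"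
      using mt(3) by (meson le_trans max.mono order_refl)
    ultimately have "keep_set (matched (s ''mt''))"
      using star_cover_mono[OF P sub] by (auto simp: keep_set_def)
    then show "wp write_kernel s (\<lambda>s. \<exists>K. keep_set K \<and> output_word s = kernel_word K)
        (n * (n * 5 + 15) + 8)"
      by (intro wp_mono[OF wp_write_kernel[OF s refl] order_refl]) auto
  qed
qed

text \<open>The kernel has at most \<open>n\<close> vertices; the bound is used because the output
  length counts towards the running time.\<close>

lemma length_kernel_word: "length (kernel_word K) \<le> length w"
proof -
  let ?m = "length (kept K)"
  have "?m \<le> n"
    using length_filter_le[of _ "[0..<n]"] by (simp add: kept_def)
  moreover have "length (kernel_word K) = ?m + (1 + (?m * ?m + ?m))"
    by (simp add: kernel_word_def length_concat o_def sum_list_triv)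
  ultimately show ?thesis
    using mult_mono[of ?m n ?m n] by (simp add: len)
qed

end

section \<open>Interpreting words as graphs\<close>

lemma input_word_unique:
  assumes "input_word w m" "input_word w n"
  shows "m = n"
  \<comment> \<open>If the sizes differed, the smaller one would be both the position of a separator
    and a position within the unary prefix.\<close>
  using assms unfolding input_word_def by (metis linorder_neqE_nat)

lemma nth_concat_matrix:
  "i < length us \<Longrightarrow> j < length vs \<Longrightarrow>
    concat (map (\<lambda>u. map (g u) vs) us) ! (i * length vs + j) = g (us ! i) (vs ! j)"
proof (induct us arbitrary: i)
  case (Cons u us)
  then show ?case
    by (cases i) (auto simp: nth_append add.assoc)
qed simp

lemma encodes_input_word:
  assumes inst: "ntst_instance G N" and enc: "encodes w G N"
  obtains vs where "distinct vs" "set vs = pverts G" "input_word w (length vs)"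
    "\<forall>i<length vs. \<forall>j<length vs.
      input_word.adj w (length vs) i j \<longleftrightarrow> (vs ! i, vs ! j) \<in> parcs G"
    "\<forall>i<length vs. input_word.nt w (length vs) i \<longleftrightarrow> vs ! i \<in> N"
proof -
  obtain vs where vs: "distinct vs" "set vs = pverts G"
    and w: "w = replicate (length vs) True @ [False] @
      concat (map (\<lambda>u. map (\<lambda>v. (u, v) \<in> parcs G) vs) vs) @ map (\<lambda>v. v \<in> N) vs"
    using enc unfolding encodes_def by blast
  let ?n = "length vs"
  let ?A = "concat (map (\<lambda>u. map (\<lambda>v. (u, v) \<in> parcs G) vs) vs)"
  have lenA: "length ?A = ?n * ?n"
    by (simp add: length_concat o_def sum_list_triv)
  have "2 \<le> card (pverts G)"
    using inst by (simp add: ntst_instance_def)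
  then have "0 < ?n"
    using vs by (metis card.empty gr0I length_0_conv list.set(1) not_numeral_le_zero)
  then interpret input_word w ?n
    by unfold_locales (simp_all add: w lenA nth_append)
  have "adj i j \<longleftrightarrow> (vs ! i, vs ! j) \<in> parcs G" if "i < ?n" "j < ?n" for i j
  proof -
    have "Suc i * ?n \<le> ?n * ?n"
      using that(1) by (intro mult_right_mono) auto
    then have "i * ?n + j < length ?A"
      using that(2) lenA by simp
    then have "w ! (?n + 1 + i * ?n + j) = ?A ! (i * ?n + j)"
      by (simp add: w nth_append)
    with nth_concat_matrix[OF that, of "\<lambda>u v. (u, v) \<in> parcs G"] show ?thesis
      by (simp add: adj_def)
  qed
  moreover have "nt i \<longleftrightarrow> vs ! i \<in> N" if "i < ?n" for i
  proof -
    have "w ! (?n + 1 + ?n * ?n + i) \<longleftrightarrow> vs ! i \<in> N"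
      using that lenA by (simp add: w nth_append)
    then show ?thesis
      by (simp add: nt_def)
  qed
  ultimately show thesis
    using that[of vs] vs input_word_axioms by blast
qed

text \<open>The enumeration \<open>vs\<close> is injective, so it carries a star cover on indices to
  an expansion in \<open>G\<close>; the kernel is enumerated by the kept indices in their original
  order.\<close>

lemma kernel_word_correct:
  assumes inst: "ntst_instance G N" and vs: "distinct vs" "set vs = pverts G"
    and iw: "input_word w (length vs)"
    and adj': "\<forall>i<length vs. \<forall>j<length vs.
      input_word.adj w (length vs) i j \<longleftrightarrow> (vs ! i, vs ! j) \<in> parcs G"
    and nt': "\<forall>i<length vs. input_word.nt w (length vs) i \<longleftrightarrow> vs ! i \<in> N"
    and K: "input_word.keep_set w (length vs) K"
  shows "\<exists>G'. ntst_instance G' N \<and> encodes (input_word.kernel_word w (length vs) K) G' N \<and>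
    (ntst_yes G' N \<longleftrightarrow> ntst_yes G N) \<and> card (pverts G') \<le> (if card N = 0 then 2 else 3 * card N)"
proof -
  let ?n = "length vs"
  interpret input_word w ?n
    by fact
  note adj = adj'[rule_format] and nt = nt'[rule_format]
  let ?f = "(!) vs"
  have inj: "inj_on ?f {i. i < ?n}"
    using vs(1) by (auto simp: inj_on_def nth_eq_iff_index_eq)
  have eqI: "i = j" if "vs ! i = vs ! j" "i < ?n" "j < ?n" for i j
    using that vs(1) by (simp add: nth_eq_iff_index_eq)
  have pG: "pair_graph G" and N: "N \<subseteq> pverts G"
    using inst by (auto simp: ntst_instance_def)
  have G: "finite (pverts G)" "sym (parcs G)" "irrefl (parcs G)"
    using pG by (auto simp: pair_graph_conv)
  have K1: "K \<subseteq> {i. i < ?n \<and> \<not> nt i}" and K2: "2 \<le> card K"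
    and K3: "card K \<le> max 2 (2 * card {i. i < ?n \<and> nt i})" and "\<exists>P. star_cover K P"
    using K by (auto simp: keep_set_def)
  then obtain P where P: "star_cover K P"
    by blast
  have P1: "b \<in> K \<and> b < ?n \<and> a < ?n \<and> vs ! a \<in> N \<and> (vs ! b, vs ! a) \<in> parcs G" if "(b, a) \<in> P" for b a
    using P that K1 nt adj unfolding star_cover_def by blast
  let ?K = "?f ` K" and ?P = "map_prod ?f ?f ` P"
  have sub: "?K \<subseteq> pverts G - N"
    using K1 nt by (auto simp flip: vs(2))
  have cardK: "card ?K = card K"
    using K1 by (intro card_image inj_on_subset[OF inj]) auto
  have "?f ` {i. i < ?n \<and> nt i} = N"
  proof
    show "?f ` {i. i < ?n \<and> nt i} \<subseteq> N"
      using nt by auto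
    show "N \<subseteq> ?f ` {i. i < ?n \<and> nt i}"
    proof
      fix x
      assume "x \<in> N"
      moreover from this obtain i where "i < ?n" "x = vs ! i"
        using N vs(2) by (metis in_set_conv_nth subsetD)
      ultimately show "x \<in> ?f ` {i. i < ?n \<and> nt i}"
        using nt by blast
    qed
  qed
  moreover have "card (?f ` {i. i < ?n \<and> nt i}) = card {i. i < ?n \<and> nt i}"
    by (intro card_image inj_on_subset[OF inj]) auto
  ultimately have cardN: "card {i. i < ?n \<and> nt i} = card N"
    by simp
  have exp: "expansion G N ?K ?P"
    unfolding expansion_def
  proof (intro conjI ballI impI)
    show "?P \<subseteq> parcs G" "?P \<subseteq> ?K \<times> N"
      using P1 by auto
    show "single_valued ?P"
    proof (rule single_valuedI)
      fix x y z
      assume "(x, y) \<in> ?P" "(x, z) \<in> ?P"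
      then obtain b a b' a' where *: "(b, a) \<in> P" "(b', a') \<in> P" "vs ! b = x" "vs ! b' = x"
          "y = vs ! a" "z = vs ! a'"
        by auto
      then have "b = b'"
        using P1 eqI by metis
      with * show "y = z"
        using P unfolding star_cover_def by (metis single_valuedD)
    qed
  next
    fix x
    assume "x \<in> Range ?P"
    then obtain a where a: "a \<in> Range P" "x = vs ! a"
      by auto
    have "2 \<le> card (P\<inverse> `` {a})"
      using P a(1) unfolding star_cover_def by blast
    also have "\<dots> = card (?f ` (P\<inverse> `` {a}))"
      using P1 by (intro card_image[symmetric] inj_on_subset[OF inj]) auto
    also have "\<dots> \<le> card (?P\<inverse> `` {x})"
    proof (rule card_mono)
      have "?P\<inverse> `` {x} \<subseteq> pverts G"
        using P1 vs(2) by fastforce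
      then show "finite (?P\<inverse> `` {x})"
        using G(1) finite_subset by blast
      show "?f ` (P\<inverse> `` {a}) \<subseteq> ?P\<inverse> `` {x}"
        using a(2) by force
    qed
    finally show "2 \<le> card (?P\<inverse> `` {x})" .
  next
    fix y x
    assume y: "y \<in> pverts G - N" "y \<notin> ?K \<or> y \<in> Domain ?P" and x: "x \<in> N" "(y, x) \<in> parcs G"
    obtain b where b: "b < ?n" "y = vs ! b"
      using y(1) vs(2) by (metis Diff_iff in_set_conv_nth)
    obtain a where a: "a < ?n" "x = vs ! a"
      using x(1) N vs(2) by (metis in_set_conv_nth subsetD)
    have "b \<notin> K \<or> b \<in> Domain P"
    proof (cases "y \<in> ?K")
      case True
      then obtain b' a' where "(b', a') \<in> P" "y = vs ! b'"
        using y(2) by auto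
      with b show ?thesis
        using P1 eqI by blast
    qed (use b in auto)
    then have "a \<in> Range P"
      using P a b x y(1) adj nt unfolding star_cover_def by blast
    with a(2) show "x \<in> Range ?P"
      by force
  qed
  have "2 \<le> card ?K"
    using K2 cardK by simp
  note kg = ntst_instance_kernel_graph[OF inst sub this exp] ntst_yes_kernel_graph[OF inst sub this exp]
  have "card (N \<union> ?K) \<le> card N + card K"
    using card_Un_le[of N ?K] cardK by simp
  \<comment> \<open>For \<open>card N > 0\<close> at most \<open>2 * card N\<close> terminals join
    the non-terminals; for \<open>card N = 0\<close> the kernel consists of at most two
    terminals.\<close>
  then have size: "card (pverts (kernel_graph G N ?K)) \<le> (if card N = 0 then 2 else 3 * card N)"
    using K3 cardN by auto
  have kept: "i \<in> set (kept K) \<longleftrightarrow> i < ?n \<and> (vs ! i \<in> N \<or> i \<in> K)" for i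
    using nt by (auto simp: kept_def)
  \<comment> \<open>A kept index is a non-terminal or lies in \<open>K\<close>, never both.\<close>
  have mem: "vs ! i \<in> ?K \<longleftrightarrow> vs ! i \<notin> N" if "i \<in> set (kept K)" for i
    using that sub K1 eqI by (auto simp: kept)
  have "encodes (kernel_word K) (kernel_graph G N ?K) N"
    unfolding encodes_def
  proof (intro exI conjI)
    let ?vs = "map ?f (kept K)"
    have "distinct (kept K)"
      by (simp add: kept_def)
    then show "distinct ?vs"
      using eqI kept by (auto simp: distinct_map inj_on_def)
    have "N \<subseteq> ?f ` set (kept K)"
    proof
      fix x
      assume "x \<in> N"
      moreover from this obtain i where "i < ?n" "x = vs ! i"
        using N vs(2) by (metis in_set_conv_nth subsetD)
      ultimately show "x \<in> ?f ` set (kept K)"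
        using kept by auto
    qed
    moreover have "K \<subseteq> set (kept K)"
      using K1 kept by auto
    ultimately show "set ?vs = pverts (kernel_graph G N ?K)"
      using kept by auto
    have arc: "kernel_arc u v \<longleftrightarrow> (vs ! u, vs ! v) \<in> parcs (kernel_graph G N ?K)"
      if "u \<in> set (kept K)" "v \<in> set (kept K)" for u v
    proof -
      have "u < ?n" "v < ?n"
        using that kept by auto
      then have "kernel_arc u v \<longleftrightarrow>
          (vs ! u, vs ! v) \<in> parcs G \<or> vs ! u \<notin> N \<and> vs ! v \<notin> N \<and> vs ! u \<noteq> vs ! v"
        using adj nt eqI by (auto simp: kernel_arc_def)
      also have "\<dots> \<longleftrightarrow> (vs ! u, vs ! v) \<in> parcs (kernel_graph G N ?K)"
        by (simp add: mem[OF that(1)] mem[OF that(2)])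
      finally show ?thesis .
    qed
    have "map nt (kept K) = map (\<lambda>v. v \<in> N) ?vs"
      using nt kept by auto
    moreover have "map (\<lambda>u. map (kernel_arc u) (kept K)) (kept K) =
        map (\<lambda>u. map (\<lambda>v. (u, v) \<in> parcs (kernel_graph G N ?K)) ?vs) ?vs"
      using arc by (simp del: kernel_graph_simps)
    ultimately show "kernel_word K = replicate (length ?vs) True @ [False] @
        concat (map (\<lambda>u. map (\<lambda>v. (u, v) \<in> parcs (kernel_graph G N ?K)) ?vs) ?vs) @
        map (\<lambda>v. v \<in> N) ?vs"
      by (simp only: kernel_word_def length_map)
  qed
  with kg size show ?thesis
    by blast
qed

theorem theorem2:
  shows "\<exists>f :: bool list \<Rightarrow> bool list.
    poly_time_computable_on
      {w. \<exists>(G :: nat pair_pre_digraph) N. ntst_instance G N \<and> encodes w G N} f \<and>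
    (\<forall>(G :: nat pair_pre_digraph) N w. ntst_instance G N \<and> encodes w G N \<longrightarrow>
      (\<exists>(G' :: nat pair_pre_digraph) N'.
        ntst_instance G' N' \<and> encodes (f w) G' N' \<and>
        (ntst_yes G' N' \<longleftrightarrow> ntst_yes G N) \<and>
        card N' \<le> card N \<and>
        card (pverts G') \<le> (if card N = 0 then 2 else 3 * card N)))"
proof -
  \<comment> \<open>The number of vertices is bounded by the word length, so both arguments become
    the variable; the last summand pays for the length of the output.\<close>
  define p :: "nat poly" where "p = kernel_time [:0, 1:] [:0, 1:] + [:0, 1:]"
  \<comment> \<open>No graph occurs in \<open>result\<close>, so the choice of an output depends on
    the word alone, while the size \<open>n\<close> and the kept set \<open>K\<close> remain
    available for every graph that the word encodes.\<close>
  define result where "result w v \<longleftrightarrow> (\<exists>t s n K. exec kernelize (input_store w) t s \<and>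
    output_word s = v \<and> t + length v \<le> poly p (length w) \<and> input_word w n \<and>
    input_word.keep_set w n K \<and> v = input_word.kernel_word w n K)" for w v
  have ex: "\<exists>v. result w v" if inst: "ntst_instance G N" and enc: "encodes w G N"
    for G :: "nat pair_pre_digraph" and N w
  proof -
    obtain vs where vs: "distinct vs" "set vs = pverts G" and iw: "input_word w (length vs)"
      and "\<forall>i<length vs. \<forall>j<length vs.
        input_word.adj w (length vs) i j \<longleftrightarrow> (vs ! i, vs ! j) \<in> parcs G"
      and nt: "\<forall>i<length vs. input_word.nt w (length vs) i \<longleftrightarrow> vs ! i \<in> N"
      by (rule encodes_input_word[OF inst enc])
    interpret input_word w "length vs"
      by fact
    have fin: "finite (pverts G)" "N \<subseteq> pverts G" "card N + 2 \<le> card (pverts G)"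
      using inst by (auto simp: ntst_instance_def pair_graph_conv)
    have "pverts G - N \<subseteq> (!) vs ` {i. i < length vs \<and> \<not> nt i}"
    proof
      fix x
      assume x: "x \<in> pverts G - N"
      then obtain i where "i < length vs" "x = vs ! i"
        using vs(2) by (metis Diff_iff in_set_conv_nth)
      with x nt show "x \<in> (!) vs ` {i. i < length vs \<and> \<not> nt i}"
        by blast
    qed
    then have "card (pverts G - N) \<le> card {i. i < length vs \<and> \<not> nt i}"
      by (intro surj_card_le) auto
    moreover have "2 \<le> card (pverts G - N)"
      using fin by (simp add: card_Diff_subset finite_subset)
    ultimately have "2 \<le> card {i. i < length vs \<and> \<not> nt i}"
      by linarith
    from wp_kernelize[OF this] obtain t s K where *: "exec kernelize (input_store w) t s"
      "t \<le> kernel_time (length vs) (length w)" "keep_set K" "output_word s = kernel_word K"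
      unfolding wp_def by blast
    have "length vs \<le> length w"
      by (simp add: len)
    then have "t \<le> kernel_time (length w) (length w)"
      using *(2) kernel_time_mono le_trans by blast
    then have "t + length (kernel_word K) \<le> poly p (length w)"
      using length_kernel_word[of K] by (simp only: p_def poly_add poly_kernel_time) simp
    then have "result w (kernel_word K)"
      unfolding result_def using *(1,3,4) iw by (intro exI conjI) simp_all
    then show ?thesis ..
  qed
  define f where "f w = (SOME v. result w v)" for w
  have f: "result w (f w)" if "ntst_instance G N" "encodes w G N"
    for G :: "nat pair_pre_digraph" and N w
    unfolding f_def by (rule someI_ex) (rule ex[OF that])
  show ?thesis
  proof (intro exI[of _ f] conjI allI impI)
    show "poly_time_computable_on
        {w. \<exists>(G :: nat pair_pre_digraph) N. ntst_instance G N \<and> encodes w G N} f"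
      unfolding poly_time_computable_on_def
    proof (intro exI[of _ kernelize] exI[of _ p] ballI)
      fix w
      assume "w \<in> {w. \<exists>(G :: nat pair_pre_digraph) N. ntst_instance G N \<and> encodes w G N}"
      then have "result w (f w)"
        using f by auto
      then show "\<exists>t s. exec kernelize (input_store w) t s \<and> output_word s = f w \<and>
          t + length (f w) \<le> poly p (length w)"
        by (auto simp: result_def)
    qed
  next
    fix G :: "nat pair_pre_digraph" and N w
    assume "ntst_instance G N \<and> encodes w G N"
    then have inst: "ntst_instance G N" and enc: "encodes w G N"
      by auto
    obtain vs where vs: "distinct vs" "set vs = pverts G" "input_word w (length vs)"
      "\<forall>i<length vs. \<forall>j<length vs.
        input_word.adj w (length vs) i j \<longleftrightarrow> (vs ! i, vs ! j) \<in> parcs G"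
      "\<forall>i<length vs. input_word.nt w (length vs) i \<longleftrightarrow> vs ! i \<in> N"
      by (rule encodes_input_word[OF inst enc])
    obtain n K where n: "input_word w n" and K: "input_word.keep_set w n K"
      "f w = input_word.kernel_word w n K"
      using f[OF inst enc] unfolding result_def by blast
    have "n = length vs"
      using input_word_unique[OF n vs(3)] .
    with K have K: "input_word.keep_set w (length vs) K"
      and fw: "f w = input_word.kernel_word w (length vs) K"
      by simp_all
    show "\<exists>(G' :: nat pair_pre_digraph) N'. ntst_instance G' N' \<and> encodes (f w) G' N' \<and>
        (ntst_yes G' N' \<longleftrightarrow> ntst_yes G N) \<and> card N' \<le> card N \<and>
        card (pverts G') \<le> (if card N = 0 then 2 else 3 * card N)"
      using kernel_word_correct[OF inst vs K] unfolding fw by blast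
  qed
qed

end
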